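(* Let $n\ge 1$ and let $T$ be the real symmetric tridiagonal $n\times n$ matrix with diagonal entries (from top left to bottom right) $a_n,a_{n-1},\dots,a_1\in\mathbb R$ and positive off-diagonal entries (from top to bottom) $b_{n-1},b_{n-2},\dots,b_1>0$. Let $\lambda_1>\cdots>\lambda_n$ be the eigenvalues of $T$ and let $q_k>0$ be the first component of the normalized eigenvector of $T$ for $\lambda_k$, so that $\sum_{k=1}^n q_k^2=1$. Then the Jacobian $J$ for the change of variables from $(a_n,\dots,a_1,b_{n-1},\dots,b_1)$ to $(\lambda_1,\dots,\lambda_n,q_1,\dots,q_{n-1})$, i.e. the positive function with $$\prod_{j=1}^n da_j\prod_{j=1}^{n-1}db_j = J\,\prod_{j=1}^n d\lambda_j\prod_{j=1}^{n-1}dq_j ,$$ is $$J=\frac{1}{q_n}\,\frac{\prod_{i=1}^{n-1}b_i}{\prod_{i=1}^n q_i}.$$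
   Context: Each such $T$ has distinct eigenvalues, and the first component of every eigenvector is non-zero; the eigenvectors are normalized to have unit length and signed so that the first component is positive. The $2n-1$ variables $(a_n,\dots,a_1,b_{n-1},\dots,b_1)$ with $b_i>0$ are in one-to-one correspondence with the $2n-1$ variables $(\lambda_1,\dots,\lambda_n,q_1,\dots,q_{n-1})$ with $\lambda_1>\cdots>\lambda_n$, $q_i>0$, $\sum_{i<n}q_i^2<1$; here $q_n=\sqrt{1-\sum_{i<n}q_i^2}$. The Jacobian means the absolute value of the Jacobian determinant. *)

theory Defs
  imports "HOL-Analysis.Analysis" "Jordan_Normal_Form.Spectral_Radius"
begin

text \<open>
  Rows and columns are numbered from 0, so row \<open>i\<close> carries the diagonal entry \<open>a (n - i)\<close>,
  and positions \<open>(i, i + 1)\<close> and \<open>(i + 1, i)\<close> carry \<open>b (n - 1 - i)\<close>.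
  Only \<open>a 1, ..., a n\<close> and \<open>b 1, ..., b (n - 1)\<close> are used.
\<close>

definition tridiag :: "nat \<Rightarrow> (nat \<Rightarrow> real) \<Rightarrow> (nat \<Rightarrow> real) \<Rightarrow> real mat" where
  "tridiag n a b = Matrix.mat n n (\<lambda>(i, j).
     if i = j then a (n - i)
     else if j = i + 1 then b (n - 1 - i)
     else if i = j + 1 then b (n - 1 - j)
     else 0)"

text \<open>The \<open>k\<close>-th largest eigenvalue, counted from \<open>k = 1\<close>.\<close>

definition eigval :: "real mat \<Rightarrow> nat \<Rightarrow> real" where
  "eigval A k = rev (sorted_list_of_set (spectrum A)) ! (k - 1)"

definition normalized_eigenvector :: "real mat \<Rightarrow> real \<Rightarrow> real Matrix.vec \<Rightarrow> bool" where
  "normalized_eigenvector A \<mu> v \<longleftrightarrow>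
     eigenvector A v \<mu> \<and> scalar_prod v v = 1 \<and> vec_index v 0 > 0"

definition first_comp :: "real mat \<Rightarrow> nat \<Rightarrow> real" where
  "first_comp A k = vec_index (THE v. normalized_eigenvector A (eigval A k) v) 0"

text \<open>
  Both coordinate systems live in \<open>real ^ 'd\<close>, where \<open>e\<close> enumerates the index type \<open>'d\<close> by
  \<open>0, ..., 2 * n - 2\<close>.  A point lists its coordinates, along \<open>e\<close>, in the order
  \<open>a n, ..., a 1, b (n - 1), ..., b 1\<close> on the matrix side and
  \<open>lambda 1, ..., lambda n, q 1, ..., q (n - 1)\<close> on the spectral side.
\<close>

definition coord_a :: "nat \<Rightarrow> (nat \<Rightarrow> 'd) \<Rightarrow> real ^ 'd \<Rightarrow> nat \<Rightarrow> real" where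
  "coord_a n e x j = vec_nth x (e (n - j))"

definition coord_b :: "nat \<Rightarrow> (nat \<Rightarrow> 'd) \<Rightarrow> real ^ 'd \<Rightarrow> nat \<Rightarrow> real" where
  "coord_b n e x j = vec_nth x (e (n + (n - 1 - j)))"

definition coord_lambda :: "nat \<Rightarrow> (nat \<Rightarrow> 'd) \<Rightarrow> real ^ 'd \<Rightarrow> nat \<Rightarrow> real" where
  "coord_lambda n e y k = vec_nth y (e (k - 1))"

definition coord_q :: "nat \<Rightarrow> (nat \<Rightarrow> 'd) \<Rightarrow> real ^ 'd \<Rightarrow> nat \<Rightarrow> real" where
  "coord_q n e y k = vec_nth y (e (n + (k - 1)))"

definition tridiag_of :: "nat \<Rightarrow> (nat \<Rightarrow> 'd) \<Rightarrow> real ^ 'd \<Rightarrow> real mat" where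
  "tridiag_of n e x = tridiag n (coord_a n e x) (coord_b n e x)"

definition matrix_domain :: "nat \<Rightarrow> (nat \<Rightarrow> 'd) \<Rightarrow> (real ^ 'd) set" where
  "matrix_domain n e = {x. \<forall>j\<in>{1..<n}. coord_b n e x j > 0}"

definition spectral_domain :: "nat \<Rightarrow> (nat \<Rightarrow> 'd) \<Rightarrow> (real ^ 'd) set" where
  "spectral_domain n e = {y.
     (\<forall>k\<in>{1..<n}. coord_lambda n e y k > coord_lambda n e y (k + 1)) \<and>
     (\<forall>k\<in>{1..<n}. coord_q n e y k > 0) \<and>
     (\<Sum>k\<in>{1..<n}. (coord_q n e y k)\<^sup>2) < 1}"

definition spectral_map :: "nat \<Rightarrow> (nat \<Rightarrow> 'd) \<Rightarrow> real ^ 'd \<Rightarrow> real ^ 'd" where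
  "spectral_map n e x = (\<chi> i.
     let p = inv_into {..<2 * n - 1} e i; T = tridiag_of n e x
     in if p < n then eigval T (p + 1) else first_comp T (p - n + 1))"

end

theory Submission imports Defs begin

text \<open>
  Let \<open>P\<^sub>k\<close> be the monic orthogonal polynomials of \<open>T\<close>, \<open>h\<^sub>k\<close> the product of the first \<open>k\<close>
  off-diagonal entries and \<open>w\<^sub>j = q\<^sub>j\<^sup>2\<close>.  The eigenvector for \<open>\<lambda>\<^sub>j\<close> has components \<open>q\<^sub>j P\<^sub>k(\<lambda>\<^sub>j) / h\<^sub>k\<close>,
  so \<open>\<Sum>\<^sub>j w\<^sub>j P\<^sub>k(\<lambda>\<^sub>j) P\<^sub>l(\<lambda>\<^sub>j) = \<delta>\<^sub>k\<^sub>l h\<^sub>k\<^sup>2\<close>, and running the Lanczos recursion on \<open>(\<lambda>, w)\<close>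
  inverts the spectral map by an explicit differentiable formula.

  Number the entries \<open>a\<close>, \<open>b\<close> of \<open>T\<close> from the top, starting with \<open>0\<close>.
  Differentiating the orthogonality relations at frozen polynomials shows that the differential of
  \<open>p \<mapsto> \<Sum>\<^sub>j w\<^sub>j p(\<lambda>\<^sub>j)\<close> takes the value \<open>h\<^sub>k\<^sup>2 (da\<^sub>0 + \<dots> + da\<^sub>k)\<close> at \<open>P\<^sub>k P\<^sub>k\<^sub>+\<^sub>1\<close> and
  \<open>2 h\<^sub>k\<^sup>2 (db\<^sub>0 / b\<^sub>0 + \<dots> + db\<^sub>k\<^sub>-\<^sub>1 / b\<^sub>k\<^sub>-\<^sub>1)\<close> at \<open>P\<^sub>k\<^sup>2\<close>: a triangular system in the entries of \<open>T\<close>.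
  On the spectral side these polynomials, monic of degrees \<open>1, \<dots>, 2n - 1\<close>, may be replaced by
  \<open>P\<^sub>1, \<dots>, P\<^sub>n\<^sub>-\<^sub>1, P\<^sub>0 \<chi>, \<dots>, P\<^sub>n\<^sub>-\<^sub>1 \<chi>\<close> with \<open>\<chi> = P\<^sub>n\<close>, which makes the coefficient matrix
  block triangular with blocks built from \<open>W = (P\<^sub>i(\<lambda>\<^sub>j))\<close> and \<open>\<chi>'(\<lambda>\<^sub>j)\<close>.  Since
  \<open>\<bar>\<Prod>\<^sub>j \<chi>'(\<lambda>\<^sub>j)\<bar> = (det W)\<^sup>2\<close> and \<open>(det W)\<^sup>2 \<Prod>\<^sub>j w\<^sub>j = \<Prod>\<^sub>k h\<^sub>k\<^sup>2\<close>, all Vandermonde factors cancel.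
\<close>

section \<open>Orthogonal polynomials of a Jacobi matrix\<close>

text \<open>Characteristic polynomials of the leading principal blocks. The ring is left general
  because roots are counted over the complex numbers, while the rest of the argument lives over the
  reals.\<close>

fun jacobi_poly :: "(nat \<Rightarrow> 'a::comm_ring_1) \<Rightarrow> (nat \<Rightarrow> 'a) \<Rightarrow> nat \<Rightarrow> 'a poly" where
  "jacobi_poly \<alpha> \<beta> 0 = 1"
| "jacobi_poly \<alpha> \<beta> (Suc 0) = [:- \<alpha> 0, 1:]"
| "jacobi_poly \<alpha> \<beta> (Suc (Suc k)) =
     [:- \<alpha> (Suc k), 1:] * jacobi_poly \<alpha> \<beta> (Suc k) - Polynomial.smult ((\<beta> k)\<^sup>2) (jacobi_poly \<alpha> \<beta> k)"

lemma jacobi_poly_degree_monic: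
  fixes \<alpha> \<beta> :: "nat \<Rightarrow> 'a::idom"
  shows "degree (jacobi_poly \<alpha> \<beta> k) = k \<and> lead_coeff (jacobi_poly \<alpha> \<beta> k) = 1"
proof (induction k rule: less_induct)
  case (less k)
  show ?case
  proof (cases "k < 2")
    case True
    then have "k = 0 \<or> k = Suc 0" by auto
    then show ?thesis by auto
  next
    case False
    then obtain m where k: "k = Suc (Suc m)" by (metis add_2_eq_Suc le_add_diff_inverse not_less)
    let ?p = "[:- \<alpha> (Suc m), 1:] * jacobi_poly \<alpha> \<beta> (Suc m)"
    have a: "m < k" "Suc m < k" using k by auto
    have IH: "degree (jacobi_poly \<alpha> \<beta> m) = m" "degree (jacobi_poly \<alpha> \<beta> (Suc m)) = Suc m"
      "lead_coeff (jacobi_poly \<alpha> \<beta> (Suc m)) = 1"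
      using less[OF a(1)] less[OF a(2)] by blast+
    have nz: "jacobi_poly \<alpha> \<beta> (Suc m) \<noteq> 0" using IH(3) by fastforce
    have dp: "degree ?p = k" using nz IH k by (subst degree_mult_eq) auto
    have lp: "lead_coeff ?p = 1" using IH(3) by (subst lead_coeff_mult) simp
    have ds: "degree (Polynomial.smult ((\<beta> m)\<^sup>2) (jacobi_poly \<alpha> \<beta> m)) < k"
      using IH(1) k by (intro order.strict_trans1[OF degree_smult_le]) simp
    have e: "jacobi_poly \<alpha> \<beta> k = ?p + (- Polynomial.smult ((\<beta> m)\<^sup>2) (jacobi_poly \<alpha> \<beta> m))"
      by (simp add: k)
    have ds': "degree (- Polynomial.smult ((\<beta> m)\<^sup>2) (jacobi_poly \<alpha> \<beta> m)) < degree ?p" 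
      unfolding dp degree_minus by (rule ds)
    show ?thesis unfolding e degree_add_eq_left[OF ds'] using dp lp ds' 
      by (simp only: coeff_add coeff_eq_0) simp
  qed
qed

lemma jacobi_poly_degree [simp]:
  fixes \<alpha> \<beta> :: "nat \<Rightarrow> 'a::idom" shows "degree (jacobi_poly \<alpha> \<beta> k) = k"
  using jacobi_poly_degree_monic[of \<alpha> \<beta> k] by simp

lemma jacobi_poly_monic [simp]:
  fixes \<alpha> \<beta> :: "nat \<Rightarrow> 'a::idom" shows "coeff (jacobi_poly \<alpha> \<beta> k) k = 1"
  using jacobi_poly_degree_monic[of \<alpha> \<beta> k] by simp

lemma jacobi_poly_nonzero [simp]:
  fixes \<alpha> \<beta> :: "nat \<Rightarrow> 'a::idom" shows "jacobi_poly \<alpha> \<beta> k \<noteq> 0"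
  using jacobi_poly_monic[of \<alpha> \<beta> k] by (metis coeff_0 zero_neq_one)

text \<open>One-step form of the recursion: the conditional absorbs the missing predecessor at
  \<open>k = 0\<close>, so an induction can treat all \<open>k\<close> alike.\<close>

lemma poly_jacobi_poly_rec:
  "poly (jacobi_poly \<alpha> \<beta> (Suc k)) x =
     (x - \<alpha> k) * poly (jacobi_poly \<alpha> \<beta> k) x - (if k = 0 then 0 else (\<beta> (k - 1))\<^sup>2
       * poly (jacobi_poly \<alpha> \<beta> (k - 1)) x)"
  by (cases k) (auto simp: algebra_simps)

lemma jacobi_poly_cong:
  assumes "\<And>i. i < k \<Longrightarrow> \<alpha> i = \<alpha>' i" "\<And>i. Suc i < k \<Longrightarrow> \<beta> i = \<beta>' i"
  shows "jacobi_poly \<alpha> \<beta> k = jacobi_poly \<alpha>' \<beta>' k"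
  using assms by (induction \<alpha> \<beta> k rule: jacobi_poly.induct) auto

definition offprod :: "(nat \<Rightarrow> 'a::comm_monoid_mult) \<Rightarrow> nat \<Rightarrow> 'a" where
  "offprod \<beta> k = (\<Prod>i<k. \<beta> i)"

lemma offprod_simps [simp]: "offprod \<beta> 0 = 1" "offprod \<beta> (Suc k) = offprod \<beta> k * \<beta> k"
  by (simp_all add: offprod_def mult.commute)

lemma offprod_pos:
  fixes \<beta> :: "nat \<Rightarrow> real"
  assumes "\<And>i. i < k \<Longrightarrow> \<beta> i > 0"
  shows "offprod \<beta> k > 0"
  using assms by (auto simp: offprod_def intro!: prod_pos)

lemma offprod_nonzero:
  fixes \<beta> :: "nat \<Rightarrow> 'a::field"
  assumes "\<And>i. i < k \<Longrightarrow> \<beta> i \<noteq> 0"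
  shows "offprod \<beta> k \<noteq> 0"
  using assms by (auto simp: offprod_def)

section \<open>Christoffel-Darboux identities and reality of the roots\<close>

text \<open>When the recursions at \<open>x\<close> and \<open>y\<close> are cross-multiplied, the
  \<open>\<alpha>\<close> terms cancel. Each step then adds exactly one summand, and the sum
  telescopes.\<close>

lemma christoffel_darboux:
  fixes x y :: "'a::field"
  assumes "\<And>i. i < m \<Longrightarrow> \<beta> i \<noteq> 0"
  shows "(x - y) * (\<Sum>k\<le>m. poly (jacobi_poly \<alpha> \<beta> k) x * poly (jacobi_poly \<alpha> \<beta> k) y / (offprod \<beta> k)\<^sup>2) =
    (poly (jacobi_poly \<alpha> \<beta> (Suc m)) x * poly (jacobi_poly \<alpha> \<beta> m) y
      - poly (jacobi_poly \<alpha> \<beta> m) x * poly (jacobi_poly \<alpha> \<beta> (Suc m)) y) / (offprod \<beta> m)\<^sup>2"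
  using assms
proof (induction m)
  case (Suc m)
  have nz: "\<beta> m \<noteq> 0" "offprod \<beta> m \<noteq> 0" using Suc.prems offprod_nonzero[of m \<beta>] by auto
  have "(x - y) * (\<Sum>k\<le>Suc m. poly (jacobi_poly \<alpha> \<beta> k) x * poly (jacobi_poly \<alpha> \<beta> k) y / (offprod \<beta> k)\<^sup>2)
     = (poly (jacobi_poly \<alpha> \<beta> (Suc m)) x * poly (jacobi_poly \<alpha> \<beta> m) y
      - poly (jacobi_poly \<alpha> \<beta> m) x * poly (jacobi_poly \<alpha> \<beta> (Suc m)) y) / (offprod \<beta> m)\<^sup>2
      + (x - y) * poly (jacobi_poly \<alpha> \<beta> (Suc m)) x * poly (jacobi_poly \<alpha> \<beta> (Suc m)) y
        / (offprod \<beta> (Suc m))\<^sup>2"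
    using Suc by (simp add: distrib_left)
  also have "\<dots> = (poly (jacobi_poly \<alpha> \<beta> (Suc (Suc m))) x * poly (jacobi_poly \<alpha> \<beta> (Suc m)) y
      - poly (jacobi_poly \<alpha> \<beta> (Suc m)) x * poly (jacobi_poly \<alpha> \<beta> (Suc (Suc m))) y)
        / (offprod \<beta> (Suc m))\<^sup>2"
    using nz by (simp del: jacobi_poly.simps add: poly_jacobi_poly_rec[of _ _ "Suc m"]
      power_mult_distrib field_simps)
  finally show ?case .
qed simp

text \<open>The limit of the previous identity as \<open>y\<close> tends to \<open>x\<close>,
  obtained by the same induction on the differentiated recursion; this keeps it valid over any
  field.\<close>

lemma christoffel_darboux_confluent:
  fixes x :: "'a::field"
  assumes "\<And>i. i < m \<Longrightarrow> \<beta> i \<noteq> 0"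
  shows "(\<Sum>k\<le>m. (poly (jacobi_poly \<alpha> \<beta> k) x)\<^sup>2 / (offprod \<beta> k)\<^sup>2) =
    (poly (pderiv (jacobi_poly \<alpha> \<beta> (Suc m))) x * poly (jacobi_poly \<alpha> \<beta> m) x
      - poly (pderiv (jacobi_poly \<alpha> \<beta> m)) x * poly (jacobi_poly \<alpha> \<beta> (Suc m)) x) / (offprod \<beta> m)\<^sup>2"
  using assms
proof (induction m)
  case 0 show ?case by (simp add: pderiv_pCons)
next
  case (Suc m)
  have nz: "\<beta> m \<noteq> 0" "offprod \<beta> m \<noteq> 0" using Suc.prems offprod_nonzero[of m \<beta>] by auto
  have d: "poly (pderiv (jacobi_poly \<alpha> \<beta> (Suc (Suc m)))) x = poly (jacobi_poly \<alpha> \<beta> (Suc m)) x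
      + (x - \<alpha> (Suc m)) * poly (pderiv (jacobi_poly \<alpha> \<beta> (Suc m))) x - (\<beta> m)\<^sup>2
        * poly (pderiv (jacobi_poly \<alpha> \<beta> m)) x"
    by (simp only: jacobi_poly.simps pderiv_mult pderiv_diff pderiv_smult)
      (simp add: pderiv_pCons algebra_simps del: jacobi_poly.simps)
  have "(\<Sum>k\<le>Suc m. (poly (jacobi_poly \<alpha> \<beta> k) x)\<^sup>2 / (offprod \<beta> k)\<^sup>2)
     = (poly (pderiv (jacobi_poly \<alpha> \<beta> (Suc m))) x * poly (jacobi_poly \<alpha> \<beta> m) x
      - poly (pderiv (jacobi_poly \<alpha> \<beta> m)) x * poly (jacobi_poly \<alpha> \<beta> (Suc m)) x) / (offprod \<beta> m)\<^sup>2
      + (poly (jacobi_poly \<alpha> \<beta> (Suc m)) x)\<^sup>2 / (offprod \<beta> (Suc m))\<^sup>2"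
    using Suc by simp
  also have "\<dots> = (poly (pderiv (jacobi_poly \<alpha> \<beta> (Suc (Suc m)))) x * poly (jacobi_poly \<alpha> \<beta> (Suc m)) x
      - poly (pderiv (jacobi_poly \<alpha> \<beta> (Suc m))) x * poly (jacobi_poly \<alpha> \<beta> (Suc (Suc m))) x)
        / (offprod \<beta> (Suc m))\<^sup>2"
    using nz unfolding d
    by (simp del: jacobi_poly.simps add: poly_jacobi_poly_rec[of _ _ "Suc m"] power_mult_distrib
      field_simps power2_eq_square)
  finally show ?case .
qed

lemma poly_jacobi_poly_cnj:
  "poly (jacobi_poly (\<lambda>i. complex_of_real (\<alpha> i)) (\<lambda>i. complex_of_real (\<beta> i)) k) (cnj z)
     = cnj (poly (jacobi_poly (\<lambda>i. complex_of_real (\<alpha> i)) (\<lambda>i. complex_of_real (\<beta> i)) k) z)"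
proof (induction k rule: less_induct)
  case (less k)
  then show ?case
    by (cases k) (auto simp del: jacobi_poly.simps simp: jacobi_poly.simps(1) poly_jacobi_poly_rec)
qed

lemma poly_jacobi_poly_of_real:
  "poly (jacobi_poly (\<lambda>i. complex_of_real (\<alpha> i)) (\<lambda>i. complex_of_real (\<beta> i)) k) (of_real x)
     = of_real (poly (jacobi_poly \<alpha> \<beta> k) x)"
proof (induction k rule: less_induct)
  case (less k)
  then show ?case
    by (cases k) (auto simp del: jacobi_poly.simps simp: jacobi_poly.simps(1) poly_jacobi_poly_rec)
qed

text \<open>Over the complex numbers, Christoffel-Darboux at a root \<open>z\<close> and its
  conjugate multiplies \<open>z - cnj z\<close> by a positive sum, so \<open>z\<close> is real. At a
  double root the confluent form would make the same positive sum vanish. Hence all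
  \<open>Suc m\<close> complex roots are simple and real.\<close>

lemma card_roots_jacobi_poly:
  fixes \<alpha> \<beta> :: "nat \<Rightarrow> real"
  assumes nz: "\<And>i. i < m \<Longrightarrow> \<beta> i \<noteq> 0"
  shows "card {x. poly (jacobi_poly \<alpha> \<beta> (Suc m)) x = 0} = Suc m"
proof -
  let ?a = "\<lambda>i. complex_of_real (\<alpha> i)" and ?b = "\<lambda>i. complex_of_real (\<beta> i)"
  let ?P = "jacobi_poly ?a ?b"
  have nz': "\<And>i. i < m \<Longrightarrow> ?b i \<noteq> 0" using nz by simp
  have hr: "offprod ?b k = of_real (offprod \<beta> k)" for k by (induction k) auto
  define N where "N z = (\<Sum>k\<le>m. (cmod (poly (?P k) z))\<^sup>2 / (offprod \<beta> k)\<^sup>2)" for z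
  \<comment> \<open>The term \<open>k = 0\<close> alone equals 1.\<close>
  have N: "N z > 0" for z
  proof -
    have "(cmod (poly (?P 0) z))\<^sup>2 / (offprod \<beta> 0)\<^sup>2 \<le> N z" 
      unfolding N_def by (rule member_le_sum) auto
    then show ?thesis by simp
  qed
  have Nc: "(\<Sum>k\<le>m. poly (?P k) z * poly (?P k) (cnj z) / (offprod ?b k)\<^sup>2) = of_real (N z)" for z
    unfolding N_def hr poly_jacobi_poly_cnj of_real_sum of_real_divide
      complex_norm_square[symmetric] by simp
  have real: "cnj z = z" if "poly (?P (Suc m)) z = 0" for z
  proof -
    have "(z - cnj z) * of_real (N z) = 0"
      using christoffel_darboux[where m = m and \<beta> = ?b and x = z and y = "cnj z" and \<alpha> = ?a, OF nz'] that
      unfolding Nc by (simp del: jacobi_poly.simps add: poly_jacobi_poly_cnj)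
    then show ?thesis using N[of z] by simp
  qed
  have sq: "rsquarefree (?P (Suc m))"
    unfolding rsquarefree_roots
  proof (intro allI notI)
    fix z assume z: "poly (?P (Suc m)) z = 0 \<and> poly (pderiv (?P (Suc m))) z = 0"
    have "(\<Sum>k\<le>m. (poly (?P k) z)\<^sup>2 / (offprod ?b k)\<^sup>2) = 0"
      using christoffel_darboux_confluent[where m = m and \<beta> = ?b and x = z and \<alpha> = ?a, OF nz'] z by simp
    then have "of_real (N z) = (0::complex)"
      unfolding Nc[of z, symmetric] real[OF conjunct1[OF z]] power2_eq_square .
    with N[of z] show False by simp
  qed
  let ?R = "{z. poly (?P (Suc m)) z = 0}"
  \<comment> \<open>A square-free complex polynomial is a constant times the product of its distinct
    linear factors, so its degree counts the distinct roots.\<close>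
  have "degree (\<Prod>z\<in>?R. [:- z, 1:]) = Suc m"
    using arg_cong[OF complex_poly_decompose_rsquarefree[OF sq], of degree] 
    by (simp del: jacobi_poly.simps)
  moreover have "degree (\<Prod>z\<in>?R. [:- z, 1:]) = card ?R"
    by (subst degree_prod_eq_sum_degree) auto
  moreover have "?R = complex_of_real ` {x. poly (jacobi_poly \<alpha> \<beta> (Suc m)) x = 0}"
  proof -
    have "z \<in> complex_of_real ` {x. poly (jacobi_poly \<alpha> \<beta> (Suc m)) x = 0}" if "z \<in> ?R" for z
    proof -
      have "z \<in> \<real>" unfolding Reals_cnj_iff using real[of z] that by blast
      then obtain x where "z = of_real x" by (rule Reals_cases)
      then show ?thesis using that by (auto simp del: jacobi_poly.simps simp: poly_jacobi_poly_of_real)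
    qed
    then show ?thesis by (auto simp del: jacobi_poly.simps simp: poly_jacobi_poly_of_real)
  qed
  moreover have "card (complex_of_real ` {x. poly (jacobi_poly \<alpha> \<beta> (Suc m)) x = 0})
    = card {x. poly (jacobi_poly \<alpha> \<beta> (Suc m)) x = 0}"
    by (rule card_image) (auto simp: inj_on_def)
  ultimately show ?thesis by simp
qed

section \<open>Determinants\<close>

text \<open>Arrays given as index functions keep dimension conditions out of the identities and let
  the size vary with \<open>n\<close>, unlike a determinant over an index type.\<close>

definition fdet :: "nat \<Rightarrow> (nat \<Rightarrow> nat \<Rightarrow> 'a::comm_ring_1) \<Rightarrow> 'a" where
  "fdet n f = Determinant.det (Matrix.mat n n (\<lambda>(i, j). f i j))"

lemma fdet_cong:
  assumes "\<And>i j. i < n \<Longrightarrow> j < n \<Longrightarrow> f i j = g i j"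
  shows "fdet n f = fdet n g"
proof -
  have "Matrix.mat n n (\<lambda>(i, j). f i j) = Matrix.mat n n (\<lambda>(i, j). g i j)"
    using assms by (intro eq_matI) auto
  then show ?thesis by (simp add: fdet_def)
qed

lemma fdet_mult:
  fixes f g :: "nat \<Rightarrow> nat \<Rightarrow> 'a::idom"
  shows "fdet n f * fdet n g = fdet n (\<lambda>i j. \<Sum>k<n. f i k * g k j)"
proof -
  let ?F = "Matrix.mat n n (\<lambda>(i, j). f i j)" and ?G = "Matrix.mat n n (\<lambda>(i, j). g i j)"
  have "Determinant.det ?F * Determinant.det ?G = Determinant.det (?F * ?G)"
    by (subst det_mult[of _ n]) auto
  also have "?F * ?G = Matrix.mat n n (\<lambda>(i, j). \<Sum>k<n. f i k * g k j)"
    by (intro eq_matI) (auto simp: scalar_prod_def lessThan_atLeast0)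
  finally show ?thesis by (simp add: fdet_def)
qed

lemma fdet_transpose: "fdet n (\<lambda>i j. f j i) = fdet n f"
proof -
  have "Matrix.mat n n (\<lambda>(i, j). f j i) = transpose_mat (Matrix.mat n n (\<lambda>(i, j). f i j))"
    by (intro eq_matI) auto
  then show ?thesis unfolding fdet_def by (simp add: det_transpose[of _ n])
qed

lemma fdet_lower:
  assumes "\<And>i j. i < j \<Longrightarrow> j < n \<Longrightarrow> f i j = 0"
  shows "fdet n f = (\<Prod>i<n. f i i)"
  unfolding fdet_def using assms
  by (subst det_lower_triangular[of n]) (auto simp: prod_list_diag_prod lessThan_atLeast0)

lemma fdet_permute_rows:
  assumes "p permutes {0..<n}"
  shows "fdet n (\<lambda>i j. f (p i) j) = of_int (sign p) * fdet n f"
proof -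
  have "p i < n" if "i < n" for i using permutes_in_image[OF assms, of i] that by auto
  then have "Matrix.mat n n (\<lambda>(i, j). f (p i) j)
      = Matrix.mat n n (\<lambda>(i, j). Matrix.mat n n (\<lambda>(i, j). f i j) $$ (p i, j))"
    by (intro eq_matI) auto
  then show ?thesis
    unfolding fdet_def using det_permute_rows[OF _ assms, of "Matrix.mat n n (\<lambda>(i, j). f i j)"] by simp
qed

lemma fdet_scale_cols: "fdet n (\<lambda>i j. f i j * d j) = fdet n f * (\<Prod>j<n. d j)"
  for f :: "nat \<Rightarrow> nat \<Rightarrow> 'a::idom"
proof -
  have "fdet n f * fdet n (\<lambda>i j. if i = j then d j else 0) = fdet n (\<lambda>i j. f i j * d j)"
    unfolding fdet_mult by (intro fdet_cong) (simp add: sum.delta' if_distrib cong: if_cong)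
  moreover have "fdet n (\<lambda>i j. if i = j then d j else 0) = (\<Prod>j<n. d j)"
    by (subst fdet_lower) auto
  ultimately show ?thesis by simp
qed

lemma fdet_block_upper_right_zero:
  fixes f :: "nat \<Rightarrow> nat \<Rightarrow> 'a::idom"
  assumes "\<And>i j. i < n \<Longrightarrow> j < m \<Longrightarrow> f i (n + j) = 0"
  shows "fdet (n + m) f = fdet n f * fdet m (\<lambda>i j. f (n + i) (n + j))"
proof -
  have eq: "Matrix.mat (n + m) (n + m) (\<lambda>(i, j). f i j) =
    four_block_mat (Matrix.mat n n (\<lambda>(i, j). f i j)) (0\<^sub>m n m)
      (Matrix.mat m n (\<lambda>(i, j). f (n + i) j)) (Matrix.mat m m (\<lambda>(i, j). f (n + i) (n + j)))"
  proof (rule eq_matI)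
    fix i j assume "i < dim_row (four_block_mat (Matrix.mat n n (\<lambda>(i, j). f i j)) (0\<^sub>m n m)
      (Matrix.mat m n (\<lambda>(i, j). f (n + i) j)) (Matrix.mat m m (\<lambda>(i, j). f (n + i) (n + j))))"
      "j < dim_col (four_block_mat (Matrix.mat n n (\<lambda>(i, j). f i j)) (0\<^sub>m n m)
      (Matrix.mat m n (\<lambda>(i, j). f (n + i) j)) (Matrix.mat m m (\<lambda>(i, j). f (n + i) (n + j))))"
    then show "Matrix.mat (n + m) (n + m) (\<lambda>(i, j). f i j) $$ (i, j)
      = four_block_mat (Matrix.mat n n (\<lambda>(i, j). f i j)) (0\<^sub>m n m)
      (Matrix.mat m n (\<lambda>(i, j). f (n + i) j)) (Matrix.mat m m (\<lambda>(i, j). f (n + i) (n + j))) $$ (i, j)"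
      using assms[of i "j - n"] by auto
  qed auto
  show ?thesis
    unfolding fdet_def eq by (rule det_four_block_mat_upper_right_zero) auto
qed

lemma fdet_first_row_last:
  fixes f :: "nat \<Rightarrow> nat \<Rightarrow> 'a::idom"
  assumes "\<And>j. j < m \<Longrightarrow> f 0 j = 0"
  shows "fdet (Suc m) f = (- 1) ^ m * f 0 m * fdet m (\<lambda>i j. f (Suc i) j)"
proof -
  let ?A = "Matrix.mat (Suc m) (Suc m) (\<lambda>(i, j). f i j)"
  have "Determinant.det ?A = (\<Sum>j<Suc m. ?A $$ (0, j) * cofactor ?A 0 j)"
    by (rule laplace_expansion_row) auto
  also have "\<dots> = f 0 m * cofactor ?A 0 m"
    using assms by simp
  also have "mat_delete ?A 0 m = Matrix.mat m m (\<lambda>(i, j). f (Suc i) j)"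
    unfolding mat_delete_def by (intro eq_matI) auto
  then have "cofactor ?A 0 m = (- 1) ^ m * fdet m (\<lambda>i j. f (Suc i) j)"
    unfolding cofactor_def fdet_def by simp
  finally show ?thesis by (simp add: fdet_def)
qed

text \<open>Both sides are Leibniz sums; the enumeration carries permutations of
  \<open>{0..<N}\<close> to permutations of the index type and preserves signs.\<close>

lemma det_eq_fdet:
  fixes A :: "'a::comm_ring_1 ^ 'd ^ 'd"
  assumes e: "bij_betw e {..<N} (UNIV :: 'd set)"
  shows "Determinants.det A = fdet N (\<lambda>i j. A $ e i $ e j)"
proof -
  let ?S = "{0..<N}" and ?h = "map_permutation {0..<N} e"
  have e': "bij_betw e ?S UNIV" using e by (simp add: lessThan_atLeast0)
  have inj: "inj_on e ?S" and im: "e ` ?S = UNIV" using e' by (auto simp: bij_betw_def)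
  let ?g = "inv_into ?S e"
  have g: "bij_betw ?g UNIV ?S" using bij_betw_inv_into[OF e'] .
  have ge: "?g (e i) = i" if "i \<in> ?S" for i using inv_into_f_f[OF inj that] .
  have eg: "e (?g x) = x" for x using im by (simp add: f_inv_into_f)
  have "fdet N (\<lambda>i j. A $ e i $ e j) =
      (\<Sum>p | p permutes ?S. of_int (sign p) * (\<Prod>i\<in>?S. A $ e i $ e (p i)))"
  proof -
    have "Matrix.mat N N (\<lambda>(i, j). A $ e i $ e j) $$ (i, p i) = A $ e i $ e (p i)"
      if "p permutes ?S" "i \<in> ?S" for p i
      using that permutes_in_image[OF that(1), of i] by simp
    then show ?thesis unfolding fdet_def by (subst det_def'[of _ N]) (auto intro!: sum.cong prod.cong)
  qed
  also have "\<dots> = (\<Sum>p | p permutes UNIV. of_int (sign p) * (\<Prod>i\<in>UNIV. A $ i $ p i))"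
  proof (rule sum.reindex_bij_witness[where i = "map_permutation UNIV ?g" and j = ?h])
    fix p assume p: "p \<in> {p. p permutes ?S}"
    show "map_permutation UNIV ?g (?h p) = p"
      using map_permutation_compose_inv[OF e', of p ?g] p ge by auto
    show "?h p \<in> {p. p permutes UNIV}"
      using map_permutation_permutes[OF e', of p] p by auto
    have "(\<Prod>i\<in>UNIV. A $ i $ ?h p i) = (\<Prod>i\<in>?S. A $ e i $ ?h p (e i))"
      using prod.reindex_bij_betw[OF e', of "\<lambda>i. A $ i $ ?h p i"] by simp
    also have "\<dots> = (\<Prod>i\<in>?S. A $ e i $ e (p i))"
      by (rule prod.cong) (simp_all add: map_permutation_apply[OF inj])
    finally show "of_int (sign (?h p)) * (\<Prod>i\<in>UNIV. A $ i $ ?h p i)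
        = of_int (sign p) * (\<Prod>i\<in>?S. A $ e i $ e (p i))"
      using sign_map_permutation[OF inj, of p] p by simp
  next
    fix p :: "'d \<Rightarrow> 'd" assume p: "p \<in> {p. p permutes UNIV}"
    show "?h (map_permutation UNIV ?g p) = p"
      using map_permutation_compose_inv[OF g, of p e] p eg by auto
    show "map_permutation UNIV ?g p \<in> {p. p permutes ?S}"
      using map_permutation_permutes[OF g, of p] p by auto
  qed
  finally show ?thesis by (simp add: Determinants.det_def)
qed

section \<open>Determinants of monic polynomial systems\<close>

text \<open>Read \<open>t\<close> as the coefficients of a new system in an old basis and
  \<open>s r\<close> as the leading position of row \<open>r\<close>. Undoing \<open>s\<close> on
  the rows makes \<open>t\<close> lower unitriangular, so only a sign is lost.\<close>

lemma abs_fdet_unitriangular: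
  fixes t M :: "nat \<Rightarrow> nat \<Rightarrow> real"
  assumes s: "s permutes {0..<N}"
    and t1: "\<And>r. r < N \<Longrightarrow> t r (s r) = 1"
    and t0: "\<And>r d. r < N \<Longrightarrow> d < N \<Longrightarrow> s r < d \<Longrightarrow> t r d = 0"
  shows "\<bar>fdet N (\<lambda>r c. \<Sum>d<N. t r d * M d c)\<bar> = \<bar>fdet N M\<bar>"
proof -
  define u where "u = inv_into UNIV s"
  let ?B = "\<lambda>r c. \<Sum>d<N. t r d * M d c"
  have i: "u permutes {0..<N}" unfolding u_def using permutes_inv[OF s] .
  have iN: "u r < N" if "r < N" for r using permutes_in_image[OF i, of r] that by auto
  have si:  "s (u r) = r" for r unfolding u_def using permutes_inverses(1)[OF s] .
  have "fdet N (\<lambda>r c. ?B (u r) c) = fdet N (\<lambda>r d. t (u r) d) * fdet N M"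
    by (simp add: fdet_mult)
  also have "fdet N (\<lambda>r d. t (u r) d) = 1"
    using t1[OF iN] t0[OF iN] si by (subst fdet_lower) auto
  finally have "\<bar>fdet N (\<lambda>r c. ?B (u r) c)\<bar> = \<bar>fdet N M\<bar>" by simp
  then show ?thesis unfolding fdet_permute_rows[OF i, of ?B]
    by (auto simp: abs_mult sign_def split: if_splits)
qed

text \<open>Horner's scheme: the coefficients of the quotient are values at \<open>c\<close> of
  polynomials that do not depend on \<open>c\<close>. Letting \<open>c\<close> run over the roots
  thus gives an evaluation matrix of fixed polynomials.\<close>

lemma coeff_synthetic_div:
  "coeff (synthetic_div p c) k = poly (poly_shift (Suc k) p) c"
proof (induction p arbitrary: k)
  case 0 show ?case by simp
next
  case (pCons a p)
  have *: "poly_shift (Suc k) (pCons a p) = poly_shift k p" for k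
    by (simp add: poly_eq_iff coeff_poly_shift)
  show ?case
  proof (cases k)
    case 0
    have "poly_shift 0 p = p" by (simp add: poly_eq_iff coeff_poly_shift)
    then show ?thesis by (simp add: 0 *)
  next
    case (Suc m) then show ?thesis by (simp add: * pCons.IH)
  qed
qed

lemma poly_eq_sum_lessThan:
  fixes p :: "'a::comm_ring_1 poly"
  assumes "\<And>d. d \<ge> n \<Longrightarrow> coeff p d = 0"
  shows "poly p x = (\<Sum>d<n. coeff p d * x ^ d)"
proof -
  have "poly p x = (\<Sum>d\<le>degree p. coeff p d * x ^ d)" by (rule poly_altdef)
  also have "\<dots> = (\<Sum>d\<in>{..<n} \<inter> {..degree p}. coeff p d * x ^ d)"
    using assms by (intro sum.mono_neutral_right) (auto, metis mult_zero_left not_less)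
  also have "\<dots> = (\<Sum>d<n. coeff p d * x ^ d)"
    by (intro sum.mono_neutral_left) (auto simp: le_degree dest: mult_not_zero)
  finally show ?thesis .
qed

text \<open>Once the rows are sorted by degree, expansion in powers has unitriangular coefficients,
  which leaves the Vandermonde determinant up to sign.\<close>

lemma abs_fdet_monic_values:
  fixes R :: "nat \<Rightarrow> real poly"
  assumes s: "s permutes {0..<n}"
    and R: "\<And>k. k < n \<Longrightarrow> degree (R k) = s k \<and> lead_coeff (R k) = 1"
  shows "\<bar>fdet n (\<lambda>k j. poly (R k) (x j))\<bar> = \<bar>fdet n (\<lambda>k j. x j ^ k)\<bar>"
proof -
  have "fdet n (\<lambda>k j. poly (R k) (x j)) = fdet n (\<lambda>k j. \<Sum>d<n. coeff (R k) d * x j ^ d)"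
  proof (rule fdet_cong)
    fix k j assume "k < n"
    then have "degree (R k) < n" using R[of k] permutes_in_image[OF s, of k] by auto
    then show "poly (R k) (x j) = (\<Sum>d<n. coeff (R k) d * x j ^ d)"
      by (intro poly_eq_sum_lessThan coeff_eq_0) auto
  qed
  also have "\<bar>\<dots>\<bar> = \<bar>fdet n (\<lambda>k j. x j ^ k)\<bar>"
    using R by (intro abs_fdet_unitriangular[OF s]) (metis, metis coeff_eq_0)
  finally show ?thesis .
qed

text \<open>The Bezout kernel \<open>(\<chi>(x) - \<chi>(y)) / (x - y)\<close> is diagonal on the roots of \<open>\<chi>\<close>, with entries
  \<open>\<chi>'(x)\<close>; its coefficients in \<open>x\<close> are monic polynomials in \<open>y\<close>.\<close>

lemma abs_prod_pderiv_roots: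
  fixes p :: "real poly"
  assumes deg: "degree p = n" and monic: "lead_coeff p = 1"
    and roots: "\<And>j. j < n \<Longrightarrow> poly p (x j) = 0" and inj: "inj_on x {..<n}"
  shows "\<bar>\<Prod>j<n. poly (pderiv p) (x j)\<bar> = (fdet n (\<lambda>k j. x j ^ k))\<^sup>2"
proof -
  \<comment> \<open>The coefficient polynomials come in degrees \<open>n - 1, ..., 0\<close>;
    outside \<open>{0..<n}\<close> a permutation of that set must be the identity.\<close>
  let ?s = "\<lambda>i. if i < n then n - Suc i else i"
  have s: "?s permutes {0..<n}"
    by (rule bij_imp_permutes, rule bij_betw_byWitness[where f' = ?s]) auto
  define S where "S j = synthetic_div p (x j)" for j
  have S: "[:- x j, 1:] * S j = p" if "j < n" for j
    using synthetic_div_correct'[of "x j" p] roots[OF that] by (simp add: S_def)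
  have Sd: "poly (S j) y = (\<Sum>a<n. coeff (S j) a * y ^ a)" for j y
  proof (rule poly_eq_sum_lessThan)
    fix d assume "n \<le> d"
    then have "poly_shift (Suc d) p = 0"
      by (auto simp: poly_eq_iff coeff_poly_shift deg intro!: coeff_eq_0)
    then show "coeff (S j) d = 0" by (simp add: S_def coeff_synthetic_div)
  qed
  \<comment> \<open>\<open>p\<close> is \<open>x - x j\<close> times \<open>S j\<close>: at another
    root the linear factor is nonzero, and at \<open>x j\<close> the product rule leaves
    \<open>S j\<close>.\<close>
  have Sv: "poly (S j) (x i) = (if i = j then poly (pderiv p) (x j) else 0)" if "i < n" "j < n" for i j
  proof (cases "i = j")
    case True
    have "poly (pderiv p) (x j) = poly (S j) (x j)"
      unfolding S[OF that(2), symmetric]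
        by (simp only: pderiv_mult poly_add poly_mult) (simp add: pderiv_pCons)
    then show ?thesis using True by simp
  next
    case False
    then have "x i \<noteq> x j" using inj that by (auto simp: inj_on_def)
    moreover have "(x i - x j) * poly (S j) (x i) = 0"
      using roots[OF that(1)] unfolding S[OF that(2), symmetric] by auto
    ultimately show ?thesis using False by simp
  qed
  let ?V = "fdet n (\<lambda>k j. x j ^ k)"
  let ?G = "fdet n (\<lambda>a j. poly (poly_shift (Suc a) p) (x j))"
  \<comment> \<open>Summing powers of \<open>x i\<close> against the coefficients of
    \<open>S j\<close> evaluates \<open>S j\<close> at \<open>x i\<close>, so the matrix product is
    the diagonal kernel.\<close>
  have "?V * ?G = fdet n (\<lambda>i j. x i ^ j) * ?G" using fdet_transpose[of n "\<lambda>k j. x j ^ k"] by simp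
  also have "\<dots> = fdet n (\<lambda>i j. if i = j then poly (pderiv p) (x j) else 0)"
    unfolding fdet_mult by (intro fdet_cong) (simp add: Sv[symmetric] Sd, simp add: S_def
      coeff_synthetic_div mult.commute)
  also have "\<dots> = (\<Prod>j<n. poly (pderiv p) (x j))" by (subst fdet_lower) auto
  finally have e: "?V * ?G = (\<Prod>j<n. poly (pderiv p) (x j))" .
  have "\<bar>\<Prod>j<n. poly (pderiv p) (x j)\<bar> = \<bar>?V\<bar> * \<bar>?G\<bar>" unfolding e[symmetric] by (rule abs_mult)
  moreover have "\<bar>?G\<bar> = \<bar>?V\<bar>"
  proof (rule abs_fdet_monic_values[OF s])
    fix a assume a: "a < n"
    have c: "coeff (poly_shift (Suc a) p) (n - Suc a) = 1" 
      using monic deg a by (simp add: coeff_poly_shift)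
    have "degree (poly_shift (Suc a) p) \<le> n - Suc a"
      by (rule degree_le) (auto simp: coeff_poly_shift deg intro!: coeff_eq_0)
    moreover have "n - Suc a \<le> degree (poly_shift (Suc a) p)" using c by (intro le_degree) simp
    ultimately show "degree (poly_shift (Suc a) p) = ?s a \<and> lead_coeff (poly_shift (Suc a) p) = 1"
      using c a by simp
  qed
  ultimately show ?thesis by (simp add: power2_eq_square)
qed

section \<open>Eigenvalues and eigenvectors\<close>

text \<open>A left inverse of a square matrix is also a right inverse. This exchanges orthonormality
  of eigenvectors with orthogonality of polynomials, and is used in both directions.\<close>

lemma orthonormal_transpose:
  fixes f :: "nat \<Rightarrow> nat \<Rightarrow> 'a::field"
  assumes orth: "\<And>i j. i < n \<Longrightarrow> j < n \<Longrightarrow> (\<Sum>k<n. f k i * f k j) = (if i = j then 1 else 0)"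
    and kl: "k < n" "l < n"
  shows "(\<Sum>j<n. f k j * f l j) = (if k = l then 1 else 0)"
proof -
  let ?F = "Matrix.mat n n (\<lambda>(i, j). f i j)" and ?G = "Matrix.mat n n (\<lambda>(i, j). f j i)"
  have "?G * ?F = 1\<^sub>m n"
    using orth by (intro eq_matI) (auto simp: scalar_prod_def lessThan_atLeast0)
  then have "?F * ?G = 1\<^sub>m n"
    by (intro mat_mult_left_right_inverse[of ?G n ?F]) auto
  then have "(?F * ?G) $$ (k, l) = (if k = l then 1 else 0)" using kl by simp
  then show ?thesis using kl by (simp add: scalar_prod_def lessThan_atLeast0)
qed

text \<open>The diagonal entries, and after them the off-diagonal ones, are renumbered from the top,
  the order in which the polynomial recursion consumes them.\<close>

definition diag_seq :: "nat \<Rightarrow> (nat \<Rightarrow> real) \<Rightarrow> nat \<Rightarrow> real" where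
  "diag_seq n a i = a (n - i)"

definition off_seq :: "nat \<Rightarrow> (nat \<Rightarrow> real) \<Rightarrow> nat \<Rightarrow> real" where
  "off_seq n b i = b (n - 1 - i)"

text \<open>Extending \<open>v\<close> by zero at position \<open>n\<close> gives the last row the
  same three-term shape as the inner rows; there the zero cancels
  \<open>off_seq n b (n - 1)\<close>, which lies outside the matrix.\<close>

lemma tridiag_mult_vec:
  assumes v: "v \<in> carrier_vec n" and i: "i < n"
  defines "w \<equiv> \<lambda>k. if k < n then vec_index v k else 0"
  shows "vec_index (tridiag n a b *\<^sub>v v) i =
    (if i = 0 then 0 else off_seq n b (i - 1) * w (i - 1)) + diag_seq n a i * w i + off_seq n b i
      * w (Suc i)"
proof -
  have "vec_index (tridiag n a b *\<^sub>v v) i = (\<Sum>j<n. tridiag n a b $$ (i, j) * vec_index v j)"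
    using v i by (simp add: tridiag_def scalar_prod_def lessThan_atLeast0)
  also have "\<dots> = (\<Sum>j<n. (if j = i - 1 then if i = 0 then 0 else off_seq n b j * w j else 0)
      + (if j = i then diag_seq n a j * w j else 0) + (if j = Suc i then off_seq n b i * w j else 0))"
    using i by (intro sum.cong) (auto simp: tridiag_def diag_seq_def off_seq_def w_def)
  also have "\<dots> = (if i = 0 then 0 else off_seq n b (i - 1) * w (i - 1)) + diag_seq n a i * w i
    + off_seq n b i * w (Suc i)"
    using i by (auto simp: sum.distrib sum.delta' w_def)
  finally show ?thesis .
qed

lemma tridiag_dim_row [simp]: "dim_row (tridiag n a b) = n"
  by (simp add: tridiag_def)

text \<open>The rows of the eigenvalue equation, read from the top, determine each component from
  the ones before it. Keeping \<open>offprod\<close> as a factor avoids division. At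
  \<open>k = n\<close> the left side is zero, which gives the characteristic equation times
  \<open>vec_index v 0\<close>.\<close>

lemma eigenvector_tridiag_components:
  assumes ev: "eigenvector (tridiag n a b) v \<mu>" and k: "k \<le> n"
  shows "offprod (off_seq n b) k * (if k < n then vec_index v k else 0)
    = poly (jacobi_poly (diag_seq n a) (off_seq n b) k) \<mu> * vec_index v 0"
  using k
proof (induction k rule: less_induct)
  case (less k)
  have v: "v \<in> carrier_vec n" and eq: "tridiag n a b *\<^sub>v v = \<mu> \<cdot>\<^sub>v v"
    using ev by (auto simp: eigenvector_def)
  have "n \<noteq> 0"
  proof
    assume "n = 0"
    then have "v = 0\<^sub>v n" using v by auto
    then show False using ev by (simp add: eigenvector_def)
  qed
  show ?case
  proof (cases k)
    case 0 then show ?thesis using \<open>n \<noteq> 0\<close> by simp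
  next
    case (Suc m)
    then have m: "m < n" using less.prems by simp
    define w where "w k = (if k < n then vec_index v k else 0)" for k
    let ?h = "offprod (off_seq n b)" and ?P = "\<lambda>k. poly (jacobi_poly (diag_seq n a) (off_seq n b) k) \<mu>"
    have row: "(if m = 0 then 0 else off_seq n b (m - 1) * w (m - 1)) + diag_seq n a m * w m
      + off_seq n b m * w (Suc m) = \<mu> * w m"
      using tridiag_mult_vec[OF v m, of a b, folded w_def] m v unfolding eq by (simp add: w_def)
    have IH: "?h j * w j = ?P j * vec_index v 0" if "j \<le> m" for j
      using less.IH[of j] that Suc less.prems by (simp add: w_def)
    have h: "?h m = (if m = 0 then 1 else ?h (m - 1) * off_seq n b (m - 1))" by (cases m) auto
    have "?h (Suc m) * w (Suc m) = ?h m * (off_seq n b m * w (Suc m))" by simp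
    also have "off_seq n b m * w (Suc m) = (\<mu> - diag_seq n a m) * w m - (if m
      = 0 then 0 else off_seq n b (m - 1) * w (m - 1))"
      using row by (simp add: algebra_simps)
    also have "?h m * \<dots> = (\<mu> - diag_seq n a m) * (?h m * w m) -
       (if m = 0 then 0 else (off_seq n b (m - 1))\<^sup>2 * (?h (m - 1) * w (m - 1)))"
      using h by (auto simp: algebra_simps power2_eq_square)
    also have "\<dots> = ?P (Suc m) * vec_index v 0"
      using IH[of m] IH[of "m - 1"] by (simp add: poly_jacobi_poly_rec[of _ _ m] algebra_simps)
    finally show ?thesis unfolding Suc w_def .
  qed
qed

text \<open>For every row but the last the eigenvalue equation is the polynomial recursion; the root
  condition closes the last row.\<close>

lemma eigenvector_tridiagI:
  assumes n: "n \<ge> 1" and nz: "\<And>i. i < n - 1 \<Longrightarrow> off_seq n b i \<noteq> 0"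
    and root: "poly (jacobi_poly (diag_seq n a) (off_seq n b) n) \<mu> = 0" and c: "c \<noteq> 0"
  shows "eigenvector (tridiag n a b)
    (Matrix.vec n (\<lambda>k. c * poly (jacobi_poly (diag_seq n a) (off_seq n b) k) \<mu>
      / offprod (off_seq n b) k)) \<mu>"
    (is "eigenvector _ ?v _")
proof -
  let ?h = "offprod (off_seq n b)" and ?P = "\<lambda>k. poly (jacobi_poly (diag_seq n a) (off_seq n b) k) \<mu>"
  have v0: "vec_index ?v 0 \<noteq> 0" using n c by simp
  have "?v \<noteq> 0\<^sub>v n"
  proof
    assume e: "?v = 0\<^sub>v n"
    show False using v0 n unfolding e by simp
  qed
  moreover have "tridiag n a b *\<^sub>v ?v = \<mu> \<cdot>\<^sub>v ?v"
  proof (rule eq_vecI)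
    fix i assume "i < dim_vec (\<mu> \<cdot>\<^sub>v ?v)"
    then have i: "i < n" by simp
    define w where "w k = (if k < n then vec_index ?v k else 0)" for k
    have nzh: "?h k \<noteq> 0" if "k < n" for k using that by (intro offprod_nonzero nz) auto
    have w: "w k = c * ?P k / ?h k" if "k < n" for k using that by (simp add: w_def)
    \<comment> \<open>The last row has no next component, and there the right side vanishes because
      \<open>\<mu>\<close> is a root.\<close>
    have ws: "off_seq n b i * w (Suc i) = c * ?P (Suc i) / ?h i"
    proof (cases "Suc i < n")
      case True then show ?thesis using w[of "Suc i"] nz[of i] by simp
    next
      case False
      then have "Suc i = n" using i by simp
      then show ?thesis using root by (simp add: w_def del: jacobi_poly.simps)
    qed
    have h: "?h i = (if i = 0 then 1 else ?h (i - 1) * off_seq n b (i - 1))" by (cases i) auto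
    have wp: "(if i = 0 then 0 else off_seq n b (i - 1) * w (i - 1)) =
      (if i = 0 then 0 else (off_seq n b (i - 1))\<^sup>2 * (c * ?P (i - 1)) / ?h i)"
      using h w[of "i - 1"] nz[of "i - 1"] i by (auto simp: power2_eq_square)
    have "vec_index (tridiag n a b *\<^sub>v ?v) i =
      (if i = 0 then 0 else off_seq n b (i - 1) * w (i - 1)) + diag_seq n a i * w i + off_seq n b i
        * w (Suc i)"
      using tridiag_mult_vec[of ?v n i a b, folded w_def] i by simp
    also have "\<dots> = \<mu> * w i"
      unfolding wp ws w[OF i] poly_jacobi_poly_rec[of _ _ i] using nzh[OF i] by (auto simp: field_simps)
    finally show "vec_index (tridiag n a b *\<^sub>v ?v) i = vec_index (\<mu> \<cdot>\<^sub>v ?v) i"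
      using i by (simp add: w_def)
  qed simp
  ultimately show ?thesis by (simp add: eigenvector_def)
qed

text \<open>The last clause normalizes the eigenvector \<open>k \<mapsto> q\<^sub>j P\<^sub>k(\<lambda>\<^sub>j) / h\<^sub>k\<close>, whose entry at \<open>0\<close> is \<open>q\<^sub>j\<close>.\<close>

definition jacobi_spec :: "nat \<Rightarrow> (nat \<Rightarrow> real) \<Rightarrow> (nat \<Rightarrow> real) \<Rightarrow> (nat \<Rightarrow> real) \<Rightarrow> (nat \<Rightarrow> real) \<Rightarrow> bool" where
  "jacobi_spec n \<alpha> \<beta> lam q \<longleftrightarrow>
     (\<forall>i<n - 1. \<beta> i > 0) \<and> (\<forall>j<n. q j > 0) \<and> (\<forall>i j. i < j \<longrightarrow> j < n \<longrightarrow> lam j < lam i) \<and>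
     (\<forall>j<n. poly (jacobi_poly \<alpha> \<beta> n) (lam j) = 0) \<and>
     (\<forall>j<n. (q j)\<^sup>2 * (\<Sum>k<n. (poly (jacobi_poly \<alpha> \<beta> k) (lam j))\<^sup>2 / (offprod \<beta> k)\<^sup>2) = 1)"

lemma jacobi_spec_inj: "jacobi_spec n \<alpha> \<beta> lam q \<Longrightarrow> inj_on lam {..<n}"
  unfolding jacobi_spec_def inj_on_def by (metis lessThan_iff less_irrefl linorder_neqE_nat)

lemma jacobi_spec_offprod_pos: "jacobi_spec n \<alpha> \<beta> lam q \<Longrightarrow> k < n \<Longrightarrow> offprod \<beta> k > 0"
  by (rule offprod_pos) (auto simp: jacobi_spec_def)

text \<open>There are exactly \<open>n\<close> roots and the \<open>n\<close> listed ones are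
  distinct, so none is missing.\<close>

lemma jacobi_spec_roots:
  assumes s: "jacobi_spec n \<alpha> \<beta> lam q" and n: "n \<ge> 1"
  shows "{x. poly (jacobi_poly \<alpha> \<beta> n) x = 0} = lam ` {..<n}"
proof -
  obtain m where m: "n = Suc m" using n by (cases n) auto
  have "card {x. poly (jacobi_poly \<alpha> \<beta> n) x = 0} = n"
    unfolding m using s by (intro card_roots_jacobi_poly) (auto simp: jacobi_spec_def m)
  moreover have "card (lam ` {..<n}) = n" using jacobi_spec_inj[OF s] by (simp add: card_image)
  moreover have "lam ` {..<n} \<subseteq> {x. poly (jacobi_poly \<alpha> \<beta> n) x = 0}" using s
    by (auto simp: jacobi_spec_def)
  moreover have "finite {x. poly (jacobi_poly \<alpha> \<beta> n) x = 0}"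
    by (intro poly_roots_finite jacobi_poly_nonzero)
  ultimately show ?thesis by (metis card_subset_eq)
qed

lemma jacobi_spec_exists:
  assumes n: "n \<ge> 1" and pos: "\<And>i. i < n - 1 \<Longrightarrow> \<beta> i > 0"
  shows "\<exists>lam q. jacobi_spec n \<alpha> \<beta> lam q"
proof -
  obtain m where m: "n = Suc m" using n by (cases n) auto
  let ?R = "{x. poly (jacobi_poly \<alpha> \<beta> n) x = 0}"
  have card: "card ?R = n" unfolding m using pos by (intro card_roots_jacobi_poly) (force simp: m)
  have fin: "finite ?R" by (intro poly_roots_finite jacobi_poly_nonzero)
  \<comment> \<open>\<open>rev\<close> puts the roots in decreasing order; \<open>q\<close> is then
    forced by the normalization clause.\<close>
  define lam where "lam k = rev (sorted_list_of_set ?R) ! k" for k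
  define N where "N j = (\<Sum>k<n. (poly (jacobi_poly \<alpha> \<beta> k) (lam j))\<^sup>2 / (offprod \<beta> k)\<^sup>2)" for j
  define q where "q j = 1 / sqrt (N j)" for j
  have N: "N j > 0" for j
  proof -
    have "(poly (jacobi_poly \<alpha> \<beta> 0) (lam j))\<^sup>2 / (offprod \<beta> 0)\<^sup>2 \<le> N j"
      unfolding N_def by (rule member_le_sum) (use n in auto)
    then show ?thesis by simp
  qed
  have len: "length (sorted_list_of_set ?R) = n" using card by simp
  have "lam j < lam i" if "i < j" "j < n" for i j
    using strict_sorted_list_of_set[of ?R] that len
    unfolding lam_def by (auto simp: rev_nth sorted_wrt_iff_nth_less)
  moreover have "poly (jacobi_poly \<alpha> \<beta> n) (lam j) = 0" if "j < n" for j
  proof -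
    have "lam j \<in> set (rev (sorted_list_of_set ?R))"
      unfolding lam_def using that len by (intro nth_mem) simp
    then show ?thesis using fin by simp
  qed
  moreover have "q j > 0" "(q j)\<^sup>2 * N j = 1" for j
    using N[of j] by (auto simp: q_def power_divide)
  ultimately have "jacobi_spec n \<alpha> \<beta> lam q" 
    using pos unfolding jacobi_spec_def N_def by blast
  then show ?thesis by blast
qed

section \<open>Orthogonality and identification of eigenvalues and eigenvectors\<close>

text \<open>Christoffel-Darboux at two roots says that the normalized eigenvectors, the columns of
  \<open>?f\<close>, are orthonormal. Then so are the rows, which is the discrete orthogonality of
  the polynomials.\<close>

lemma jacobi_spec_orthonormal:
  assumes s: "jacobi_spec n \<alpha> \<beta> lam q" and kl: "k < n" "l < n"
  shows "(\<Sum>j<n. (q j)\<^sup>2 * poly (jacobi_poly \<alpha> \<beta> k) (lam j) * poly (jacobi_poly \<alpha> \<beta> l) (lam j)) =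
    (if k = l then (offprod \<beta> k)\<^sup>2 else 0)"
proof -
  obtain m where m: "n = Suc m" using kl by (cases n) auto
  let ?f = "\<lambda>k j. q j * poly (jacobi_poly \<alpha> \<beta> k) (lam j) / offprod \<beta> k"
  have nz: "\<beta> i \<noteq> 0" if "i < m" for i using s that by (force simp: jacobi_spec_def m)
  have f: "(\<Sum>k<n. ?f k i * ?f k j) = (if i = j then 1 else 0)" if ij: "i < n" "j < n" for i j
  proof -
    have e: "(\<Sum>k<n. ?f k i * ?f k j) = q i * q j * (\<Sum>k<n. poly (jacobi_poly \<alpha> \<beta> k) (lam i)
      * poly (jacobi_poly \<alpha> \<beta> k) (lam j) / (offprod \<beta> k)\<^sup>2)"
      unfolding sum_distrib_left by (intro sum.cong) (auto simp: power2_eq_square)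
    show ?thesis
    proof (cases "i = j")
      case True
      then show ?thesis using s ij unfolding e by (simp add: jacobi_spec_def power2_eq_square)
    next
      case False
      then have "lam i \<noteq> lam j" using jacobi_spec_inj[OF s] ij by (auto simp: inj_on_def)
      \<comment> \<open>Both boundary products contain the polynomial of degree \<open>n\<close> at
        one of its roots.\<close>
      moreover have "(lam i - lam j) * (\<Sum>k<n. poly (jacobi_poly \<alpha> \<beta> k) (lam i)
        * poly (jacobi_poly \<alpha> \<beta> k) (lam j) / (offprod \<beta> k)\<^sup>2) = 0"
        using christoffel_darboux[of m \<beta> "lam i" "lam j" \<alpha>] nz s ij
        by (simp add: jacobi_spec_def m lessThan_Suc_atMost del: jacobi_poly.simps)
      ultimately show ?thesis using False unfolding e by simp
    qed
  qed
  have h: "offprod \<beta> k \<noteq> 0" "offprod \<beta> l \<noteq> 0" using jacobi_spec_offprod_pos[OF s] kl by force+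
  have "(\<Sum>j<n. (q j)\<^sup>2 * poly (jacobi_poly \<alpha> \<beta> k) (lam j) * poly (jacobi_poly \<alpha> \<beta> l) (lam j))
     = offprod \<beta> k * offprod \<beta> l * (\<Sum>j<n. ?f k j * ?f l j)"
    unfolding sum_distrib_left using h by (intro sum.cong) (auto simp: power2_eq_square)
  also have "(\<Sum>j<n. ?f k j * ?f l j) = (if k = l then 1 else 0)"
    by (rule orthonormal_transpose[of n ?f, OF f kl])
  finally show ?thesis by (simp add: power2_eq_square)
qed

lemma jacobi_spec_sum_squares:
  assumes s: "jacobi_spec n \<alpha> \<beta> lam q" and n: "n \<ge> 1"
  shows "(\<Sum>j<n. (q j)\<^sup>2) = 1"
  using jacobi_spec_orthonormal[OF s, of 0 0] n by simp

lemma jacobi_spec_spectrum: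
  assumes s: "jacobi_spec n (diag_seq n a) (off_seq n b) lam q" and n: "n \<ge> 1"
  shows "spectrum (tridiag n a b) = lam ` {..<n}"
proof -
  let ?P = "jacobi_poly (diag_seq n a) (off_seq n b)"
  have nz: "off_seq n b i \<noteq> 0" if "i < n - 1" for i using s that by (force simp: jacobi_spec_def)
  have "eigenvalue (tridiag n a b) x \<longleftrightarrow> poly (?P n) x = 0" for x
  proof
    assume "poly (?P n) x = 0"
    from eigenvector_tridiagI[OF n nz this, of 1] show "eigenvalue (tridiag n a b) x"
      unfolding eigenvalue_def by auto
  next
    assume "eigenvalue (tridiag n a b) x"
    then obtain v where v: "eigenvector (tridiag n a b) v x" by (auto simp: eigenvalue_def)
    note c = eigenvector_tridiag_components[OF v]
    \<comment> \<open>All components are multiples of the first, so a zero first entry would force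
      \<open>v = 0\<close>.\<close>
    have "vec_index v 0 \<noteq> 0"
    proof
      assume v0: "vec_index v 0 = 0"
      have "vec_index v k = 0" if "k < n" for k
        using c[of k] that v0 jacobi_spec_offprod_pos[OF s that] by simp
      then have "v = 0\<^sub>v n" using v by (intro eq_vecI) (auto simp: eigenvector_def)
      then show False using v by (simp add: eigenvector_def)
    qed
    then show "poly (?P n) x = 0" using c[of n] by simp
  qed
  then show ?thesis using jacobi_spec_roots[OF s n] by (auto simp: spectrum_def)
qed

lemma jacobi_spec_eigval:
  assumes s: "jacobi_spec n (diag_seq n a) (off_seq n b) lam q" and n: "n \<ge> 1" and k: "k < n"
  shows "eigval (tridiag n a b) (Suc k) = lam k"
proof -
  have "sorted_list_of_set (lam ` {..<n}) = rev (map lam [0..<n])"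
  proof (subst sorted_list_of_set_unique[symmetric])
    show "finite (lam ` {..<n})" by simp
    have "sorted_wrt (<) (rev (map lam [0..<n]))"
      using s by (auto simp: sorted_wrt_iff_nth_less rev_nth jacobi_spec_def)
    then show "sorted_wrt (<) (rev (map lam [0..<n])) \<and> set (rev (map lam [0..<n])) = lam ` {..<n} \<and>
        length (rev (map lam [0..<n])) = card (lam ` {..<n})"
      using jacobi_spec_inj[OF s] by (auto simp: card_image)
  qed
  then show ?thesis using k by (simp add: eigval_def jacobi_spec_spectrum[OF s n])
qed

text \<open>An eigenvector is determined by its first component; unit length fixes the square of
  that component and positivity its sign, which leaves \<open>q j\<close>.\<close>

lemma jacobi_spec_normalized_eigenvector:
  assumes s: "jacobi_spec n (diag_seq n a) (off_seq n b) lam q" and n: "n \<ge> 1" and j: "j < n"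
  shows "normalized_eigenvector (tridiag n a b) (lam j) v \<longleftrightarrow>
    v = Matrix.vec n (\<lambda>k. q j * poly (jacobi_poly (diag_seq n a) (off_seq n b) k) (lam j)
      / offprod (off_seq n b) k)"
    (is "_ \<longleftrightarrow> v = ?u")
proof -
  let ?T = "tridiag n a b" and ?P = "\<lambda>k. poly (jacobi_poly (diag_seq n a) (off_seq n b) k) (lam j)"
  let ?h = "offprod (off_seq n b)"
  have nz: "off_seq n b i \<noteq> 0" if "i < n - 1" for i using s that by (force simp: jacobi_spec_def)
  have q: "q j > 0" and root: "?P n = 0" and norm: "(q j)\<^sup>2 * (\<Sum>k<n. (?P k)\<^sup>2 / (?h k)\<^sup>2) = 1"
    using s j by (auto simp: jacobi_spec_def)
  show ?thesis
  proof
    assume "v = ?u"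
    moreover have "eigenvector ?T ?u (lam j)" using q by (intro eigenvector_tridiagI n nz root) auto
    moreover have "scalar_prod ?u ?u = 1"
      unfolding norm[symmetric] sum_distrib_left scalar_prod_def 
      by (auto simp: lessThan_atLeast0 power2_eq_square intro!: sum.cong)
    moreover have "vec_index ?u 0 > 0" using n q by simp
    ultimately show "normalized_eigenvector ?T (lam j) v" by (simp add: normalized_eigenvector_def)
  next
    assume v: "normalized_eigenvector ?T (lam j) v"
    then have ev: "eigenvector ?T v (lam j)" and v1: "scalar_prod v v = 1" and v0: "vec_index v 0 > 0"
      by (auto simp: normalized_eigenvector_def)
    have vn: "v \<in> carrier_vec n" using ev by (simp add: eigenvector_def)
    define c where "c = vec_index v 0"
    have vk: "vec_index v k = c * (?P k / ?h k)" if "k < n" for k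
      using eigenvector_tridiag_components[OF ev, of k] that jacobi_spec_offprod_pos[OF s that]
      by (simp add: field_simps c_def)
    have "(c)\<^sup>2 * (\<Sum>k<n. (?P k)\<^sup>2 / (?h k)\<^sup>2) = (\<Sum>k<n. vec_index v k * vec_index v k)"
      unfolding sum_distrib_left using vk by (intro sum.cong) (auto simp: power2_eq_square)
    also have "\<dots> = 1" using v1 vn by (simp add: scalar_prod_def lessThan_atLeast0)
    finally have *: "(c)\<^sup>2 * (\<Sum>k<n. (?P k)\<^sup>2 / (?h k)\<^sup>2) = 1" .
    have "(\<Sum>k<n. (?P k)\<^sup>2 / (?h k)\<^sup>2) \<noteq> 0"
    proof
      assume "(\<Sum>k<n. (?P k)\<^sup>2 / (?h k)\<^sup>2) = 0"
      with norm show False by simp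
    qed
    then have "(c)\<^sup>2 = (q j)\<^sup>2" by (rule mult_right_cancel[THEN iffD1]) (simp only: * norm)
    then have "c = q j" using v0[folded c_def] q by (simp add: power2_eq_iff_nonneg)
    then show "v = ?u" using vk vn by (intro eq_vecI) auto
  qed
qed

lemma jacobi_spec_first_comp:
  assumes s: "jacobi_spec n (diag_seq n a) (off_seq n b) lam q" and n: "n \<ge> 1" and j: "j < n"
  shows "first_comp (tridiag n a b) (Suc j) = q j"
  unfolding first_comp_def jacobi_spec_eigval[OF s n j] jacobi_spec_normalized_eigenvector[OF s n j]
  using n by simp

section \<open>The Lanczos recursion\<close>

text \<open>Squared length in the discrete inner product with weights \<open>w\<close>.\<close>

definition wnorm :: "nat \<Rightarrow> (nat \<Rightarrow> real) \<Rightarrow> (nat \<Rightarrow> real) \<Rightarrow> real" where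
  "wnorm n w u = (\<Sum>j<n. w j * (u j)\<^sup>2)"

text \<open>Rayleigh quotient of multiplication by the nodes \<open>lam\<close>: the diagonal
  recursion coefficient that belongs to \<open>u\<close>.\<close>

definition wmean :: "nat \<Rightarrow> (nat \<Rightarrow> real) \<Rightarrow> (nat \<Rightarrow> real) \<Rightarrow> (nat \<Rightarrow> real) \<Rightarrow> real" where
  "wmean n lam w u = (\<Sum>j<n. w j * lam j * (u j)\<^sup>2) / wnorm n w u"

text \<open>The monic orthogonal polynomials of the discrete measure, stored as tables of values at
  the nodes. Only rational operations on nodes and weights occur, which later makes
  differentiability immediate.\<close>

fun lanczos_vec :: "nat \<Rightarrow> (nat \<Rightarrow> real) \<Rightarrow> (nat \<Rightarrow> real) \<Rightarrow> nat \<Rightarrow> nat \<Rightarrow> real" where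
  "lanczos_vec n lam w 0 j = 1"
| "lanczos_vec n lam w (Suc 0) j = lam j - wmean n lam w (lanczos_vec n lam w 0)"
| "lanczos_vec n lam w (Suc (Suc k)) j =
     (lam j - wmean n lam w (lanczos_vec n lam w (Suc k))) * lanczos_vec n lam w (Suc k) j
     - wnorm n w (lanczos_vec n lam w (Suc k)) / wnorm n w (lanczos_vec n lam w k)
       * lanczos_vec n lam w k j"

definition lanczos_alpha :: "nat \<Rightarrow> (nat \<Rightarrow> real) \<Rightarrow> (nat \<Rightarrow> real) \<Rightarrow> nat \<Rightarrow> real" where
  "lanczos_alpha n lam w k = wmean n lam w (lanczos_vec n lam w k)"

definition lanczos_beta :: "nat \<Rightarrow> (nat \<Rightarrow> real) \<Rightarrow> (nat \<Rightarrow> real) \<Rightarrow> nat \<Rightarrow> real" where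
  "lanczos_beta n lam w k = sqrt (wnorm n w (lanczos_vec n lam w (Suc k))
    / wnorm n w (lanczos_vec n lam w k))"

lemma lanczos_vec_rec:
  "lanczos_vec n lam w (Suc k) j = (lam j - lanczos_alpha n lam w k) * lanczos_vec n lam w k j
     - (if k = 0 then 0 else wnorm n w (lanczos_vec n lam w k) / wnorm n w (lanczos_vec n lam w (k
       - 1)) * lanczos_vec n lam w (k - 1) j)"
  by (cases k) (simp_all add: lanczos_alpha_def)

context
  fixes n :: nat and lam w :: "nat \<Rightarrow> real"
  assumes n: "n \<ge> 1" and w: "\<And>j. j < n \<Longrightarrow> w j > 0" and inj: "inj_on lam {..<n}"
begin


lemma wnorm_nonneg: "wnorm n w u \<ge> 0"
  unfolding wnorm_def using w by (intro sum_nonneg) (simp add: less_imp_le)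

text \<open>Norms are nonnegative, so squaring \<open>lanczos_beta\<close> returns their ratio and
  the two recursions coincide node by node.\<close>

lemma lanczos_vec_eq_poly_jacobi_poly: "lanczos_vec n lam w k j
  = poly (jacobi_poly (lanczos_alpha n lam w) (lanczos_beta n lam w) k) (lam j)"
proof (induction k rule: less_induct)
  case (less k)
  show ?case
  proof (cases k)
    case (Suc m)
    have "(lanczos_beta n lam w (m - 1))\<^sup>2 = wnorm n w (lanczos_vec n lam w m)
      / wnorm n w (lanczos_vec n lam w (m - 1))" if "m \<noteq> 0"
      using that wnorm_nonneg by (simp add: lanczos_beta_def)
    then show ?thesis using less.IH[of m] less.IH[of "m - 1"]
      by (simp add: Suc lanczos_vec_rec[of n lam w m] poly_jacobi_poly_rec[of _ _ m])
  qed simp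
qed

text \<open>A zero norm would make a nonzero polynomial of degree \<open>k < n\<close> vanish at
  \<open>n\<close> distinct nodes.\<close>

lemma wnorm_lanczos_vec_pos:
  assumes k: "k < n" shows "wnorm n w (lanczos_vec n lam w k) > 0"
proof (rule ccontr)
  assume "\<not> ?thesis"
  then have "wnorm n w (lanczos_vec n lam w k) = 0" using wnorm_nonneg[of "lanczos_vec n lam w k"]
    by simp
  then have *: "\<forall>j\<in>{..<n}. w j * (lanczos_vec n lam w k j)\<^sup>2 = 0"
    unfolding wnorm_def using w by (subst (asm) sum_nonneg_eq_0_iff) (auto simp: less_imp_le)
  have z: "lanczos_vec n lam w k j = 0" if "j < n" for j using bspec[OF *, of j] w[OF that] that by simp
  let ?p = "jacobi_poly (lanczos_alpha n lam w) (lanczos_beta n lam w) k"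
  have "lam ` {..<n} \<subseteq> {x. poly ?p x = 0}" using z by (auto simp: lanczos_vec_eq_poly_jacobi_poly)
  then have "card (lam ` {..<n}) \<le> card {x. poly ?p x = 0}"
    by (intro card_mono poly_roots_finite jacobi_poly_nonzero)
  also have "\<dots> \<le> degree ?p" by (intro poly_roots_degree jacobi_poly_nonzero)
  finally show False using k by (simp add: card_image[OF inj])
qed

text \<open>Multiplication by the nodes is self-adjoint, which is why orthogonalizing against two
  predecessors suffices. The range includes \<open>k = n\<close>, which later forces the last vector
  to vanish at the nodes.\<close>

lemma lanczos_vec_orthogonal:
  "l < k \<Longrightarrow> k \<le> n \<Longrightarrow> (\<Sum>j<n. w j * lanczos_vec n lam w l j * lanczos_vec n lam w k j) = 0"
proof (induction k arbitrary: l rule: less_induct)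
  case (less k)
  then obtain m where k: "k = Suc m" by (cases k) auto
  define ip where "ip u v = (\<Sum>j<n. w j * u j * v j)" for u v :: "nat \<Rightarrow> real"
  define N where "N k = wnorm n w (lanczos_vec n lam w k)" for k
  define d where "d k = (if k = 0 then 0 else N k / N (k - 1))" for k
  have m: "m < n" using less.prems k by simp
  have Nm: "N m > 0" "N (m - 1) > 0" using wnorm_lanczos_vec_pos m by (auto simp: N_def)
  have sym: "ip u v = ip v u" for u v unfolding ip_def by (intro sum.cong) auto
  have ipN: "ip (lanczos_vec n lam w k) (lanczos_vec n lam w k) = N k" for k
    unfolding ip_def N_def wnorm_def by (intro sum.cong) (auto simp: power2_eq_square)
  have orth: "ip (lanczos_vec n lam w i) (lanczos_vec n lam w j) = 0" if "i < j" "j \<le> m" for i j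
    using less.IH[of j i] that m k by (simp add: ip_def)
  have orth': "ip (lanczos_vec n lam w j) (lanczos_vec n lam w i) = 0" if "i < j" "j \<le> m" for i j
    using orth[OF that] sym by metis
  \<comment> \<open>The recursion solved for the product with \<open>lam\<close>;
    \<open>d 0 = 0\<close> removes the missing predecessor.\<close>
  have shift: "ip u (\<lambda>j. lam j * lanczos_vec n lam w i j) = ip u (lanczos_vec n lam w (Suc i))
    + lanczos_alpha n lam w i * ip u (lanczos_vec n lam w i) + d i * ip u (lanczos_vec n lam w (i
    - 1))" for u i
    unfolding ip_def sum_distrib_left sum.distrib[symmetric]
    by (intro sum.cong) (auto simp: lanczos_vec_rec[of n lam w i] d_def N_def algebra_simps)
  have move: "ip (lanczos_vec n lam w l) (\<lambda>j. lam j * lanczos_vec n lam w m j)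
    = ip (lanczos_vec n lam w m) (\<lambda>j. lam j * lanczos_vec n lam w l j)"
    unfolding ip_def by (intro sum.cong) auto
  \<comment> \<open>Three cases: at \<open>l = m\<close> the mean \<open>lanczos_alpha\<close> is
    the right multiple, at \<open>Suc l = m\<close> the ratio \<open>d m\<close> is, and for smaller
    \<open>l\<close> both sides vanish by induction.\<close>
  have "ip (lanczos_vec n lam w l) (\<lambda>j. lam j * lanczos_vec n lam w m j) = lanczos_alpha n lam w m
    * ip (lanczos_vec n lam w l) (lanczos_vec n lam w m) + d m
    * ip (lanczos_vec n lam w l) (lanczos_vec n lam w (m - 1))"
  proof (cases "l = m")
    case True
    have "d m * ip (lanczos_vec n lam w l) (lanczos_vec n lam w (m - 1)) = 0"
      using orth'[of "m - 1" m] True by (cases "m = 0") (auto simp: d_def)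
    moreover have "ip (lanczos_vec n lam w m) (\<lambda>j. lam j * lanczos_vec n lam w m j)
      = lanczos_alpha n lam w m * N m"
      using Nm by (auto simp: lanczos_alpha_def wmean_def N_def ip_def power2_eq_square intro!: sum.cong)
    ultimately show ?thesis using True by (simp add: ipN)
  next
    case False
    then have l: "l < m" using less.prems k by simp
    have "ip (lanczos_vec n lam w l) (\<lambda>j. lam j * lanczos_vec n lam w m j)
      = ip (lanczos_vec n lam w m) (lanczos_vec n lam w (Suc l))"
      unfolding move shift[of _ l] using orth'[OF l] orth'[of "l - 1" m] l by simp
    also have "\<dots> = d m * ip (lanczos_vec n lam w l) (lanczos_vec n lam w (m - 1))"
    proof (cases "Suc l = m")
      case True
      then have "l = m - 1" "m \<noteq> 0" by auto
      then show ?thesis using Nm True by (simp add: d_def ipN)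
    next
      case False
      then show ?thesis using l orth'[of "Suc l" m] orth[of l "m - 1"] by simp
    qed
    finally show ?thesis using orth[OF l] by simp
  qed
  then have "ip (lanczos_vec n lam w l) (lanczos_vec n lam w k) = 0"
    using shift[of "lanczos_vec n lam w l" m] k by simp
  then show ?case by (simp add: ip_def)
qed

text \<open>The ratios of norms telescope, and the starting norm is the total weight 1.\<close>

lemma offprod_lanczos_beta_square:
  assumes w1: "(\<Sum>j<n. w j) = 1" and k: "k < n"
  shows "(offprod (lanczos_beta n lam w) k)\<^sup>2 = wnorm n w (lanczos_vec n lam w k)"
  using k
proof (induction k)
  case 0
  then show ?case using w1 by (simp add: wnorm_def)
next
  case (Suc k)
  have "(lanczos_beta n lam w k)\<^sup>2 = wnorm n w (lanczos_vec n lam w (Suc k))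
    / wnorm n w (lanczos_vec n lam w k)"
    using wnorm_nonneg by (simp add: lanczos_beta_def)
  then show ?case using Suc wnorm_lanczos_vec_pos[of k] by (simp add: power_mult_distrib)
qed

text \<open>The scaled vectors form an orthonormal system. Transposing it gives the normalization of
  the eigenvectors, and its completeness gives the roots.\<close>

lemma jacobi_spec_lanczos:
  assumes w1: "(\<Sum>j<n. w j) = 1" and dec: "\<And>i j. i < j \<Longrightarrow> j < n \<Longrightarrow> lam j < lam i"
  shows "jacobi_spec n (lanczos_alpha n lam w) (lanczos_beta n lam w) lam (\<lambda>j. sqrt (w j))"
proof -
  have Bpos: "lanczos_beta n lam w i > 0" if "i < n - 1" for i
    using wnorm_lanczos_vec_pos[of i] wnorm_lanczos_vec_pos[of "Suc i"] that
      by (simp add: lanczos_beta_def)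
  have hpos: "offprod (lanczos_beta n lam w) k > 0" if "k < n" for k using Bpos that
    by (intro offprod_pos) auto
  define f where "f j k = sqrt (w j) * lanczos_vec n lam w k j / offprod (lanczos_beta n lam w) k"
    for j k
  have ss: "sqrt (w j) * sqrt (w j) = w j" if "j < n" for j using w[OF that] by simp
  have rearr: "s * a / c * (s * b / d) = (s * s) * a * b / (c * d)" for s a b c d :: real by simp
  have f: "(\<Sum>j<n. f j k * f j l) = (if k = l then 1 else 0)" if kl: "k < n" "l < n" for k l
  proof -
    have "(\<Sum>j<n. f j k * f j l) = (\<Sum>j<n. w j * lanczos_vec n lam w k j * lanczos_vec n lam w l j)
      / (offprod (lanczos_beta n lam w) k * offprod (lanczos_beta n lam w) l)"
      unfolding f_def sum_divide_distrib
    proof (intro sum.cong refl)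
      fix j assume j: "j \<in> {..<n}"
      show "sqrt (w j) * lanczos_vec n lam w k j / offprod (lanczos_beta n lam w) k * (sqrt (w j)
        * lanczos_vec n lam w l j / offprod (lanczos_beta n lam w) l) = w j
        * lanczos_vec n lam w k j * lanczos_vec n lam w l j / (offprod (lanczos_beta n lam w) k
        * offprod (lanczos_beta n lam w) l)"
        unfolding rearr[of "sqrt (w j)"] using ss[of j] j by simp
    qed
    also have "(\<Sum>j<n. w j * lanczos_vec n lam w k j * lanczos_vec n lam w l j) = (if k
      = l then (offprod (lanczos_beta n lam w) k)\<^sup>2 else 0)"
    proof (cases "k = l")
      case True
      then show ?thesis using offprod_lanczos_beta_square[OF w1 kl(1)]
        by (simp add: wnorm_def power2_eq_square mult.assoc)
    next
      case False
      have "(\<Sum>j<n. w j * lanczos_vec n lam w k j * lanczos_vec n lam w l j) = (\<Sum>j<n. w j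
        * lanczos_vec n lam w l j * lanczos_vec n lam w k j)" by (intro sum.cong) auto
      then show ?thesis using False lanczos_vec_orthogonal[of k l] lanczos_vec_orthogonal[of l k] kl
        by (cases "k < l") auto
    qed
    finally show ?thesis using hpos[OF kl(1)] by (cases "k = l") (auto simp: power2_eq_square)
  qed
  have g: "(\<Sum>k<n. f i k * f j k) = (if i = j then 1 else 0)" if "i < n" "j < n" for i j
    by (rule orthonormal_transpose[of n f, OF f that])
  have norm: "(sqrt (w j))\<^sup>2 * (\<Sum>k<n. (poly (jacobi_poly (lanczos_alpha n lam w) (lanczos_beta n lam
    w) k) (lam j))\<^sup>2 / (offprod (lanczos_beta n lam w) k)\<^sup>2) = 1" if "j < n" for j
  proof -
    have sqr: "s\<^sup>2 * (a\<^sup>2 / c\<^sup>2) = s * a / c * (s * a / c)" for s a c :: real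
      by (simp add: power2_eq_square)
    show ?thesis using g[OF that that] unfolding sum_distrib_left sqr f_def
      lanczos_vec_eq_poly_jacobi_poly by simp
  qed
  \<comment> \<open>The \<open>n\<close>-th vector, scaled by the square roots of the weights, is
    orthogonal to \<open>n\<close> orthonormal vectors in dimension \<open>n\<close>, hence
    zero.\<close>
  have root: "poly (jacobi_poly (lanczos_alpha n lam w) (lanczos_beta n lam w) n) (lam i) = 0"
    if i: "i < n" for i
  proof -
    define z where "z j = sqrt (w j) * lanczos_vec n lam w n j" for j
    have fz: "(\<Sum>j<n. f j k * z j) = 0" if k: "k < n" for k
    proof -
      have "(\<Sum>j<n. f j k * z j) = (\<Sum>j<n. w j * lanczos_vec n lam w k j * lanczos_vec n lam w n j)
        / offprod (lanczos_beta n lam w) k"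
        unfolding f_def z_def sum_divide_distrib
      proof (intro sum.cong refl)
        fix j assume j: "j \<in> {..<n}"
        show "sqrt (w j) * lanczos_vec n lam w k j / offprod (lanczos_beta n lam w) k * (sqrt (w j)
          * lanczos_vec n lam w n j) = w j * lanczos_vec n lam w k j * lanczos_vec n lam w n j
          / offprod (lanczos_beta n lam w) k"
          using rearr[of "sqrt (w j)" _ _ _ 1] ss[of j] j by simp
      qed
      then show ?thesis using lanczos_vec_orthogonal[OF k] by simp
    qed
    have "z i = (\<Sum>j<n. (if i = j then 1 else 0) * z j)" using i by (simp add: if_distrib[of "\<lambda>x. x
      * _"] cong: if_cong)
    also have "\<dots> = (\<Sum>j<n. \<Sum>k<n. f i k * (f j k * z j))"
      using g[OF i] by (intro sum.cong) (simp_all flip: sum_distrib_right mult.assoc)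
    also have "\<dots> = (\<Sum>k<n. f i k * (\<Sum>j<n. f j k * z j))"
      unfolding sum_distrib_left by (rule sum.swap)
    also have "\<dots> = 0" using fz by simp
    finally show ?thesis using w[OF i] by (simp add: z_def lanczos_vec_eq_poly_jacobi_poly)
  qed
  show ?thesis unfolding jacobi_spec_def using Bpos w dec root norm by simp
qed

end

section \<open>Recovering the matrix from its spectral data\<close>

text \<open>Uniqueness of the recursion: by induction the vectors are the values of
  \<open>jacobi_poly \<alpha> \<beta>\<close>, and orthogonality then reads off
  \<open>\<alpha> k\<close> as a mean and \<open>\<beta> k\<close> as the square root of a ratio of
  norms.\<close>

lemma jacobi_spec_imp_lanczos:
  assumes s: "jacobi_spec n \<alpha> \<beta> lam q" and n: "n \<ge> 1"
  defines "w \<equiv> \<lambda>j. (q j)\<^sup>2"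
  shows "k < n \<Longrightarrow> lanczos_alpha n lam w k = \<alpha> k" "Suc k < n \<Longrightarrow> lanczos_beta n lam w k = \<beta> k"
proof -
  let ?P = "\<lambda>k j. poly (jacobi_poly \<alpha> \<beta> k) (lam j)"
  have wq: "w j = (q j)\<^sup>2" for j by (simp add: w_def)
  note orth = jacobi_spec_orthonormal[OF s]
  have nrm: "wnorm n w (lanczos_vec n lam w k) = (offprod \<beta> k)\<^sup>2"
    if "k < n" "\<And>j. j < n \<Longrightarrow> lanczos_vec n lam w k j = ?P k j" for k
    using orth[OF that(1) that(1)] that(2) by (simp add: wnorm_def wq power2_eq_square mult.assoc)
  have al: "lanczos_alpha n lam w k = \<alpha> k"
    if k: "k < n" and v: "\<And>j. j < n \<Longrightarrow> lanczos_vec n lam w k j = ?P k j" for k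
  proof -
    \<comment> \<open>At \<open>Suc k = n\<close> the vanishing of the polynomial at all nodes takes
      the place of orthogonality.\<close>
    have o1: "(\<Sum>j<n. w j * ?P k j * ?P (Suc k) j) = 0"
    proof (cases "Suc k < n")
      case True then show ?thesis using orth[OF k True] by (simp add: wq)
    next
      case False
      then have "Suc k = n" using k by simp
      then have "?P (Suc k) j = 0" if "j < n" for j using s that by (simp add: jacobi_spec_def)
      then show ?thesis by simp
    qed
    \<comment> \<open>The recursion expands \<open>lam j\<close> times the \<open>k\<close>-th
      polynomial; by orthogonality only the middle term survives.\<close>
    have "(\<Sum>j<n. w j * lam j * (lanczos_vec n lam w k j)\<^sup>2) =
       (\<Sum>j<n. w j * ?P k j * ?P (Suc k) j) + \<alpha> k * (\<Sum>j<n. (q j)\<^sup>2 * ?P k j * ?P k j)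
       + (if k = 0 then 0 else (\<beta> (k - 1))\<^sup>2 * (\<Sum>j<n. (q j)\<^sup>2 * ?P k j * ?P (k - 1) j))"
    proof (cases "k = 0")
      case True
      then show ?thesis using v unfolding True sum_distrib_left sum.distrib[symmetric]
        by (auto intro!: sum.cong simp: wq algebra_simps power2_eq_square)
    next
      case False
      then show ?thesis unfolding if_not_P[OF False] sum_distrib_left sum.distrib[symmetric]
        by (intro sum.cong refl) (simp add: v wq poly_jacobi_poly_rec[of _ _ k] algebra_simps
          power2_eq_square)
    qed
    also have "\<dots> = \<alpha> k * (offprod \<beta> k)\<^sup>2"
      unfolding o1 orth[OF k k] using orth[OF k, of "k - 1"] k by auto
    finally show ?thesis
      using jacobi_spec_offprod_pos[OF s k] nrm[of k] k v by (simp add: lanczos_alpha_def wmean_def)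
  qed
  have be: "lanczos_beta n lam w k = \<beta> k"
    if "Suc k < n" "\<And>j. j < n \<Longrightarrow> lanczos_vec n lam w k j = ?P k j" "\<And>j. j < n
      \<Longrightarrow> lanczos_vec n lam w (Suc k) j = ?P (Suc k) j" for k
  proof -
    have "\<beta> k > 0" using s that(1) by (simp add: jacobi_spec_def)
    then show ?thesis
      using jacobi_spec_offprod_pos[OF s Suc_lessD[OF that(1)]] nrm[of k] nrm[of "Suc k"] that
      by (simp add: lanczos_beta_def power_mult_distrib)
  qed
  have v: "lanczos_vec n lam w k j = ?P k j" if "k < n" "j < n" for k j
    using that
  proof (induction k arbitrary: j rule: less_induct)
    case (less k)
    show ?case
    proof (cases k)
      case (Suc m)
      have m: "m < n" using less.prems Suc by simp
      have vm: "lanczos_vec n lam w i j = ?P i j" if "i \<le> m" "j < n" for i j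
        using less.IH[of i j] that Suc m by simp
      have "wnorm n w (lanczos_vec n lam w m) / wnorm n w (lanczos_vec n lam w (m - 1)) = (\<beta> (m
        - 1))\<^sup>2" if "m \<noteq> 0"
      proof -
        obtain i where i: "m = Suc i" using \<open>m \<noteq> 0\<close> by (cases m) auto
        show ?thesis using nrm[of m] nrm[of "m - 1"] vm[of m] vm[of "m
          - 1"] m jacobi_spec_offprod_pos[OF s, of i]
          by (simp add: i power_mult_distrib)
      qed
      then show ?thesis
        unfolding Suc lanczos_vec_rec[of _ _ _ m] poly_jacobi_poly_rec[of _ _ m]
        using al[OF m vm] vm[of m j] vm[of "m - 1" j] less.prems by simp
    qed simp
  qed
  show "k < n \<Longrightarrow> lanczos_alpha n lam w k = \<alpha> k" using al v by blast
  show "Suc k < n \<Longrightarrow> lanczos_beta n lam w k = \<beta> k" using be v by simp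
qed

text \<open>Functions read off from a point agree with given spectral data only at indices below
  \<open>n\<close>, so equality of functions is too strong a premise.\<close>

lemma lanczos_vec_cong:
  assumes "\<And>j. j < n \<Longrightarrow> w j = w' j" "\<And>j. j < n \<Longrightarrow> lam j = lam' j"
  shows "(\<forall>j<n. lanczos_vec n lam w k j = lanczos_vec n lam' w' k j) \<and> lanczos_alpha n lam w k
    = lanczos_alpha n lam' w' k"
proof (induction k rule: less_induct)
  case (less k)
  have wn: "wnorm n w u = wnorm n w' u'" if "\<And>j. j < n \<Longrightarrow> u j = u' j" for u u'
    unfolding wnorm_def using assms that by (intro sum.cong) auto
  have v: "\<forall>j<n. lanczos_vec n lam w k j = lanczos_vec n lam' w' k j"
  proof (cases k)
    case (Suc m)
    have IH: "lanczos_vec n lam w i j = lanczos_vec n lam' w' i j" if "i \<le> m" "j < n" for i j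
      using less.IH[of i] that Suc by auto
    have wnm: "wnorm n w (lanczos_vec n lam w i) = wnorm n w' (lanczos_vec n lam' w' i)" if "i \<le> m" for i
      using IH that by (intro wn) auto
    show ?thesis unfolding Suc lanczos_vec_rec[of _ _ _ m]
      using IH wnm[of m] wnm[of "m - 1"] less.IH[of m] assms Suc by auto
  qed simp
  moreover have "lanczos_alpha n lam w k = lanczos_alpha n lam' w' k"
    unfolding lanczos_alpha_def wmean_def
      using v assms wn[of "lanczos_vec n lam w k" "lanczos_vec n lam' w' k"]
    by (auto intro!: arg_cong2[where f = "(/)"] sum.cong)
  ultimately show ?case by simp
qed

lemma lanczos_beta_cong:
  assumes "\<And>j. j < n \<Longrightarrow> w j = w' j" "\<And>j. j < n \<Longrightarrow> lam j = lam' j"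
  shows "lanczos_beta n lam w k = lanczos_beta n lam' w' k"
proof -
  have "\<forall>j<n. lanczos_vec n lam w k j = lanczos_vec n lam' w' k j" for k
    using lanczos_vec_cong[where n = n and lam = lam and lam' = lam' and w = w and w' = w' and k
      = k] assms by blast
  then have "wnorm n w (lanczos_vec n lam w k) = wnorm n w' (lanczos_vec n lam' w' k)" for k
    unfolding wnorm_def using assms by (intro sum.cong) auto
  then show ?thesis by (simp add: lanczos_beta_def)
qed

text \<open>The recursion uses sums, products and quotients with nonzero denominators, and
  \<open>lanczos_beta\<close> adds a square root of a positive number; induction along the recursion
  then suffices.\<close>

lemma
  fixes n :: nat and lam w :: "nat \<Rightarrow> 'v::real_normed_vector \<Rightarrow> real" and y :: "'v"
  defines "L \<equiv> \<lambda>k y. lanczos_vec n (\<lambda>j. lam j y) (\<lambda>j. w j y) k"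
  assumes d: "\<And>j. j < n \<Longrightarrow> lam j differentiable (at y)" "\<And>j. j < n \<Longrightarrow> w j differentiable (at y)"
    and nz: "\<And>k. k < n \<Longrightarrow> wnorm n (\<lambda>j. w j y) (L k y) \<noteq> 0"
  shows lanczos_alpha_differentiable: "k < n
    \<Longrightarrow> (\<lambda>y. lanczos_alpha n (\<lambda>j. lam j y) (\<lambda>j. w j y) k) differentiable (at y)"
    and lanczos_beta_differentiable: "Suc k < n \<Longrightarrow> wnorm n (\<lambda>j. w j y) (L (Suc k) y)
      / wnorm n (\<lambda>j. w j y) (L k y) > 0 \<Longrightarrow>
       (\<lambda>y. lanczos_beta n (\<lambda>j. lam j y) (\<lambda>j. w j y) k) differentiable (at y)"
proof -
  have wn: "(\<lambda>y. wnorm n (\<lambda>j. w j y) (L k y)) differentiable (at y)"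
    if "\<And>j. j < n \<Longrightarrow> (\<lambda>y. L k y j) differentiable (at y)" for k
    unfolding wnorm_def using d that by (intro derivative_intros ballI) auto
  have al: "(\<lambda>y. lanczos_alpha n (\<lambda>j. lam j y) (\<lambda>j. w j y) k) differentiable (at y)"
    if "k < n" "\<And>j. j < n \<Longrightarrow> (\<lambda>y. L k y j) differentiable (at y)" for k
    unfolding lanczos_alpha_def wmean_def L_def[symmetric]
    using d that wn[OF that(2)] nz[OF that(1)]
    by (intro derivative_intros ballI) (auto simp: L_def)
  have v: "(\<lambda>y. L k y j) differentiable (at y)" if "k < n" "j < n" for k j
    using that
  proof (induction k arbitrary: j rule: less_induct)
    case (less k)
    show ?case
    proof (cases k)
      case 0 then show ?thesis by (simp add: L_def)
    next
      case (Suc m)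
      have m: "m < n" using less.prems Suc by simp
      have IH: "(\<lambda>y. L i y j) differentiable (at y)" if "i \<le> m" "j < n" for i j
        using less.IH[of i j] that Suc m by simp
      have eq: "L k y j = (lam j y - lanczos_alpha n (\<lambda>j. lam j y) (\<lambda>j. w j y) m) * L m y j
         - (if m = 0 then 0 else wnorm n (\<lambda>j. w j y) (L m y) / wnorm n (\<lambda>j. w j y) (L (m - 1) y)
           * L (m - 1) y j)" for y
        unfolding L_def Suc by (rule lanczos_vec_rec)
      have wnm: "(\<lambda>y. wnorm n (\<lambda>j. w j y) (L i y)) differentiable (at y)" if "i \<le> m" for i
        using IH that by (intro wn) auto
      have t: "(\<lambda>y. (lam j y - lanczos_alpha n (\<lambda>j. lam j y) (\<lambda>j. w j y) m)
        * L m y j) differentiable (at y)"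
        using d al[of m] m IH IH[of m j] less.prems by (intro derivative_intros) auto
      show ?thesis
      proof (cases "m = 0")
        case True then show ?thesis unfolding eq using t by simp
      next
        case False
        have t2: "(\<lambda>y. wnorm n (\<lambda>j. w j y) (L m y) / wnorm n (\<lambda>j. w j y) (L (m - 1) y) * L (m
          - 1) y j) differentiable (at y)"
          using wnm[of m] wnm[of "m - 1"] IH[of "m - 1" j] nz[of "m - 1"] less.prems m
          by (intro derivative_intros) auto
        show ?thesis unfolding eq if_not_P[OF False] by (rule differentiable_diff[OF t t2])
      qed
    qed
  qed
  show "k < n \<Longrightarrow> (\<lambda>y. lanczos_alpha n (\<lambda>j. lam j y) (\<lambda>j. w j y) k) differentiable (at y)" using al v
    by simp
  show "(\<lambda>y. lanczos_beta n (\<lambda>j. lam j y) (\<lambda>j. w j y) k) differentiable (at y)"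
    if k: "Suc k < n" and pos: "wnorm n (\<lambda>j. w j y) (L (Suc k) y) / wnorm n (\<lambda>j. w j y) (L k y) > 0"
  proof -
    have d1: "(\<lambda>y. wnorm n (\<lambda>j. w j y) (L (Suc k) y)
      / wnorm n (\<lambda>j. w j y) (L k y)) differentiable (at y)"
      using wn v k nz by (intro derivative_intros) auto
    have sq: "sqrt differentiable (at x)" if "x > 0" for x
      using DERIV_real_sqrt[OF that] unfolding differentiable_def
        by (auto simp: has_field_derivative_def)
    have "(\<lambda>y. sqrt (wnorm n (\<lambda>j. w j y) (L (Suc k) y)
      / wnorm n (\<lambda>j. w j y) (L k y))) differentiable (at y)"
      by (rule differentiable_compose[OF sq[OF pos] d1])
    then show ?thesis by (simp only: lanczos_beta_def L_def)
  qed
qed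

section \<open>Derivatives of the moments\<close>

text \<open>The velocity of the \<open>k\<close>-th polynomial when the entries move with velocities \<open>\<alpha>'\<close>, \<open>\<beta>'\<close>.\<close>

fun jacobi_poly_deriv :: "(nat \<Rightarrow> real) \<Rightarrow> (nat \<Rightarrow> real) \<Rightarrow> (nat \<Rightarrow> real) \<Rightarrow> (nat \<Rightarrow> real) \<Rightarrow> nat \<Rightarrow> real
  poly" where
  "jacobi_poly_deriv \<alpha> \<beta> \<alpha>' \<beta>' 0 = 0"
| "jacobi_poly_deriv \<alpha> \<beta> \<alpha>' \<beta>' (Suc 0) = [:- \<alpha>' 0:]"
| "jacobi_poly_deriv \<alpha> \<beta> \<alpha>' \<beta>' (Suc (Suc k)) =
     [:- \<alpha> (Suc k), 1:] * jacobi_poly_deriv \<alpha> \<beta> \<alpha>' \<beta>' (Suc k)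
       - Polynomial.smult (\<alpha>' (Suc k)) (jacobi_poly \<alpha> \<beta> (Suc k))
     - Polynomial.smult ((\<beta> k)\<^sup>2) (jacobi_poly_deriv \<alpha> \<beta> \<alpha>' \<beta>' k) - Polynomial.smult (2 * \<beta> k
       * \<beta>' k) (jacobi_poly \<alpha> \<beta> k)"

text \<open>The leading coefficient stays 1, so the velocity loses a degree. The next coefficient of
  the polynomial is minus the sum of the diagonal entries used so far, which explains the top
  coefficient of the velocity.\<close>

lemma jacobi_poly_deriv_coeff:
  "(\<forall>d\<ge>k. coeff (jacobi_poly_deriv \<alpha> \<beta> \<alpha>' \<beta>' k) d = 0) \<and>
   (k > 0 \<longrightarrow> coeff (jacobi_poly_deriv \<alpha> \<beta> \<alpha>' \<beta>' k) (k - 1) = - (\<Sum>i<k. \<alpha>' i))"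
proof (induction k rule: less_induct)
  case (less k)
  consider "k = 0" | "k = Suc 0" | m where "k = Suc (Suc m)" by (metis not0_implies_Suc)
  then show ?case
  proof cases
    case 2
    then show ?thesis by (auto simp: coeff_pCons split: nat.splits)
  next
    case 3
    have IH1: "coeff (jacobi_poly_deriv \<alpha> \<beta> \<alpha>' \<beta>' (Suc m)) d = 0" if "d \<ge> Suc m" for d
      using less[of "Suc m"] that 3 by auto
    have IH2: "coeff (jacobi_poly_deriv \<alpha> \<beta> \<alpha>' \<beta>' (Suc m)) m = - (\<Sum>i<Suc m. \<alpha>' i)"
      using less[of "Suc m"] 3 by auto
    have IH3: "coeff (jacobi_poly_deriv \<alpha> \<beta> \<alpha>' \<beta>' m) d = 0" if "d \<ge> m" for d using less[of m] that 3
      by auto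
    have P: "coeff (jacobi_poly \<alpha> \<beta> j) d = 0" if "d > j" for j d using that by (intro coeff_eq_0) simp
    have c: "coeff (jacobi_poly_deriv \<alpha> \<beta> \<alpha>' \<beta>' k) (Suc d) =
        coeff (jacobi_poly_deriv \<alpha> \<beta> \<alpha>' \<beta>' (Suc m)) d - \<alpha> (Suc m)
          * coeff (jacobi_poly_deriv \<alpha> \<beta> \<alpha>' \<beta>' (Suc m)) (Suc d)
        - \<alpha>' (Suc m) * coeff (jacobi_poly \<alpha> \<beta> (Suc m)) (Suc d)
        - (\<beta> m)\<^sup>2 * coeff (jacobi_poly_deriv \<alpha> \<beta> \<alpha>' \<beta>' m) (Suc d) - 2 * \<beta> m * \<beta>' m
          * coeff (jacobi_poly \<alpha> \<beta> m) (Suc d)" for d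
      unfolding 3 by (simp del: jacobi_poly.simps)
    have "coeff (jacobi_poly_deriv \<alpha> \<beta> \<alpha>' \<beta>' k) d = 0" if "d \<ge> k" for d
    proof -
      define d' where "d' = d - 1"
      have "d = Suc d'" "d' \<ge> Suc m" using that 3 by (auto simp: d'_def)
      then show ?thesis by (simp only: c) (simp add: IH1 IH3 P del: jacobi_poly.simps
        jacobi_poly_deriv.simps)
    qed
    moreover have "coeff (jacobi_poly_deriv \<alpha> \<beta> \<alpha>' \<beta>' k) (Suc m) = - (\<Sum>i<k. \<alpha>' i)"
      by (simp only: c IH2) (simp add: IH1 IH3 P 3 del: jacobi_poly.simps jacobi_poly_deriv.simps)
    ultimately show ?thesis by (simp add: 3 del: jacobi_poly_deriv.simps)
  qed simp
qed

text \<open>Chain rule with two sources: the moving argument contributes \<open>pderiv\<close>, the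
  moving coefficients contribute \<open>jacobi_poly_deriv\<close>.\<close>

lemma DERIV_poly_jacobi_poly:
  fixes \<alpha> \<beta> :: "nat \<Rightarrow> real \<Rightarrow> real"
  assumes \<alpha>: "\<And>i. i < k \<Longrightarrow> (\<alpha> i has_real_derivative \<alpha>' i) (at t)"
    and \<beta>: "\<And>i. Suc i < k \<Longrightarrow> (\<beta> i has_real_derivative \<beta>' i) (at t)"
    and x: "(x has_real_derivative x') (at t)"
  defines "P \<equiv> jacobi_poly (\<lambda>i. \<alpha> i t) (\<lambda>i. \<beta> i t)"
  shows "((\<lambda>s. poly (jacobi_poly (\<lambda>i. \<alpha> i s) (\<lambda>i. \<beta> i s) k) (x s)) has_real_derivative
    poly (pderiv (P k)) (x t) * x' + poly (jacobi_poly_deriv (\<lambda>i. \<alpha> i t) (\<lambda>i. \<beta> i t) \<alpha>' \<beta>' k) (x t))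
      (at t)"
  using \<alpha> \<beta>
proof (induction k rule: less_induct)
  case (less k)
  let ?E = "jacobi_poly_deriv (\<lambda>i. \<alpha> i t) (\<lambda>i. \<beta> i t) \<alpha>' \<beta>'" and ?Q
    = "\<lambda>s. jacobi_poly (\<lambda>i. \<alpha> i s) (\<lambda>i. \<beta> i s)"
  consider "k = 0" | "k = Suc 0" | m where "k = Suc (Suc m)" by (metis not0_implies_Suc)
  then show ?case
  proof cases
    case 1 then show ?thesis by (simp add: P_def)
  next
    case 2
    then show ?thesis using less.prems(1)[of 0] x
      by (auto simp: P_def pderiv_pCons intro!: derivative_eq_intros)
  next
    case 3
    have IH1: "((\<lambda>s. poly (?Q s (Suc m)) (x s)) has_real_derivative
        poly (pderiv (P (Suc m))) (x t) * x' + poly (?E (Suc m)) (x t)) (at t)"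
      using 3 by (intro less.IH less.prems) auto
    have IH2: "((\<lambda>s. poly (?Q s m) (x s)) has_real_derivative
        poly (pderiv (P m)) (x t) * x' + poly (?E m) (x t)) (at t)"
      using 3 by (intro less.IH less.prems) auto
    have a: "(\<alpha> (Suc m) has_real_derivative \<alpha>' (Suc m)) (at t)"
      and b: "(\<beta> m has_real_derivative \<beta>' m) (at t)"
      using 3 less.prems by auto
    have Pk: "poly (pderiv (P k)) (x t) = poly (P (Suc m)) (x t)
      + (x t - \<alpha> (Suc m) t) * poly (pderiv (P (Suc m))) (x t) - (\<beta> m t)\<^sup>2 * poly (pderiv (P m)) (x t)"
      unfolding 3 P_def by (simp only: jacobi_poly.simps pderiv_mult pderiv_diff pderiv_smult)
        (simp add: pderiv_pCons algebra_simps del: jacobi_poly.simps)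
    have "((\<lambda>s. (x s - \<alpha> (Suc m) s) * poly (?Q s (Suc m)) (x s) - (\<beta> m s)\<^sup>2
      * poly (?Q s m) (x s)) has_real_derivative
      ((x' - \<alpha>' (Suc m)) * poly (P (Suc m)) (x t)
       + (x t - \<alpha> (Suc m) t) * (poly (pderiv (P (Suc m))) (x t) * x' + poly (?E (Suc m)) (x t))
       - (2 * \<beta> m t * \<beta>' m * poly (P m) (x t)
          + (\<beta> m t)\<^sup>2 * (poly (pderiv (P m)) (x t) * x' + poly (?E m) (x t))))) (at t)"
      unfolding P_def
      by (rule derivative_eq_intros IH1[unfolded P_def] IH2[unfolded P_def] a b x refl)+ (simp add:
        algebra_simps del: jacobi_poly.simps jacobi_poly_deriv.simps)
    moreover have "(x s - \<alpha> (Suc m) s) * poly (?Q s (Suc m)) (x s) - (\<beta> m s)\<^sup>2 * poly (?Q s m) (x s)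
      = poly (?Q s k) (x s)" for s
      by (simp add: 3 algebra_simps)
    moreover have "poly (?E k) (x t) = (x t - \<alpha> (Suc m) t) * poly (?E (Suc m)) (x t)
      - \<alpha>' (Suc m) * poly (P (Suc m)) (x t) - (\<beta> m t)\<^sup>2 * poly (?E m) (x t) - 2 * \<beta> m t * \<beta>' m
        * poly (P m) (x t)"
      by (simp add: 3 P_def algebra_simps del: jacobi_poly.simps)
    ultimately show ?thesis
      by (elim DERIV_cong[rotated] | simp only:) (simp add: Pk algebra_simps)
  qed
qed

text \<open>The sum is the logarithmic derivative of the squared product.\<close>

lemma DERIV_offprod_square:
  fixes \<beta> :: "nat \<Rightarrow> real \<Rightarrow> real"
  assumes "\<And>i. i < k \<Longrightarrow> (\<beta> i has_real_derivative \<beta>' i) (at t)" "\<And>i. i < k \<Longrightarrow> \<beta> i t \<noteq> 0"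
  shows "((\<lambda>s. (offprod (\<lambda>i. \<beta> i s) k)\<^sup>2) has_real_derivative
    (offprod (\<lambda>i. \<beta> i t) k)\<^sup>2 * (\<Sum>i<k. 2 * \<beta>' i / \<beta> i t)) (at t)"
  using assms
proof (induction k)
  case (Suc k)
  have IH: "((\<lambda>s. (offprod (\<lambda>i. \<beta> i s) k)\<^sup>2) has_real_derivative
    (offprod (\<lambda>i. \<beta> i t) k)\<^sup>2 * (\<Sum>i<k. 2 * \<beta>' i / \<beta> i t)) (at t)"
    using Suc.prems by (intro Suc.IH) auto
  have D: "((\<lambda>s. (offprod (\<lambda>i. \<beta> i s) k)\<^sup>2 * (\<beta> k s)\<^sup>2) has_real_derivative
    (offprod (\<lambda>i. \<beta> i t) k)\<^sup>2 * (\<Sum>i<k. 2 * \<beta>' i / \<beta> i t) * (\<beta> k t)\<^sup>2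
      + (offprod (\<lambda>i. \<beta> i t) k)\<^sup>2 * (2 * \<beta> k t * \<beta>' k)) (at t)"
    by (rule derivative_eq_intros IH Suc.prems(1) lessI refl)+ (simp add: algebra_simps)
  have eq: "(offprod (\<lambda>i. \<beta> i t) k)\<^sup>2 * (\<Sum>i<k. 2 * \<beta>' i / \<beta> i t) * (\<beta> k t)\<^sup>2
      + (offprod (\<lambda>i. \<beta> i t) k)\<^sup>2 * (2 * \<beta> k t * \<beta>' k)
      = (offprod (\<lambda>i. \<beta> i t) (Suc k))\<^sup>2 * (\<Sum>i<Suc k. 2 * \<beta>' i / \<beta> i t)"
    using Suc.prems(2)[of k] by (simp add: power_mult_distrib field_simps power2_eq_square)
  show ?case using DERIV_cong[OF D eq] by (simp only: offprod_simps power_mult_distrib)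
qed simp

section \<open>Pairings with orthogonal polynomials and the differentiated relations\<close>

text \<open>Subtracting a multiple of \<open>P m\<close> removes the top coefficient, so
  \<open>p\<close> is a combination of lower \<open>P i\<close>. Bounding coefficients instead of
  the degree keeps the zero polynomial inside the induction.\<close>

lemma pair_lower_degree:
  fixes lam w :: "nat \<Rightarrow> real" and P :: "nat \<Rightarrow> real poly"
  assumes P: "\<And>k. degree (P k) = k" "\<And>k. coeff (P k) k = 1"
    and orth: "\<And>i. i < k \<Longrightarrow> (\<Sum>j<n. w j * poly (P i) (lam j) * poly (P k) (lam j)) = 0"
    and p: "\<And>d. d \<ge> m \<Longrightarrow> coeff p d = 0" and m: "m \<le> k"
  shows "(\<Sum>j<n. w j * poly p (lam j) * poly (P k) (lam j)) = 0"
  using p m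
proof (induction m arbitrary: p)
  case 0
  then have "p = 0" by (simp add: poly_eq_iff)
  then show ?case by simp
next
  case (Suc m)
  define r where "r = p - Polynomial.smult (coeff p m) (P m)"
  have r: "coeff r d = 0" if "d \<ge> m" for d
  proof (cases "d = m")
    case False
    then have "coeff (P m) d = 0" using that P(1)[of m] by (intro coeff_eq_0) simp
    then show ?thesis using Suc.prems(1)[of d] that False by (simp add: r_def)
  qed (simp add: r_def P)
  have "(\<Sum>j<n. w j * poly p (lam j) * poly (P k) (lam j)) =
    (\<Sum>j<n. w j * poly r (lam j) * poly (P k) (lam j)) + coeff p m * (\<Sum>j<n. w j * poly (P m) (lam j)
      * poly (P k) (lam j))"
    unfolding sum_distrib_left sum.distrib[symmetric]
      by (intro sum.cong) (auto simp: r_def algebra_simps)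
  then show ?case using Suc.IH[OF r] orth[of m] Suc.prems(2) by simp
qed

lemma pair_leading_coeff:
  fixes lam w :: "nat \<Rightarrow> real" and P :: "nat \<Rightarrow> real poly"
  assumes P: "\<And>k. degree (P k) = k" "\<And>k. coeff (P k) k = 1"
    and orth: "\<And>i. i < k \<Longrightarrow> (\<Sum>j<n. w j * poly (P i) (lam j) * poly (P k) (lam j)) = 0"
    and p: "\<And>d. d > k \<Longrightarrow> coeff p d = 0"
  shows "(\<Sum>j<n. w j * poly p (lam j) * poly (P k) (lam j)) =
    coeff p k * (\<Sum>j<n. w j * poly (P k) (lam j) * poly (P k) (lam j))"
proof -
  define r where "r = p - Polynomial.smult (coeff p k) (P k)"
  have r: "coeff r d = 0" if "d \<ge> k" for d
  proof (cases "d = k")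
    case False
    then have "coeff (P k) d = 0" using that P(1)[of k] by (intro coeff_eq_0) simp
    then show ?thesis using p[of d] that False by (simp add: r_def)
  qed (simp add: r_def P)
  have "(\<Sum>j<n. w j * poly p (lam j) * poly (P k) (lam j)) =
    (\<Sum>j<n. w j * poly r (lam j) * poly (P k) (lam j)) + coeff p k * (\<Sum>j<n. w j * poly (P k) (lam j)
      * poly (P k) (lam j))"
    unfolding sum_distrib_left sum.distrib[symmetric]
      by (intro sum.cong) (auto simp: r_def algebra_simps)
  moreover have "(\<Sum>j<n. w j * poly r (lam j) * poly (P k) (lam j)) = 0"
    by (rule pair_lower_degree[OF P orth r order_refl])
  ultimately show ?thesis by simp
qed

text \<open>Velocity of \<open>\<Sum>j<n. w j * poly p (lam j)\<close> for fixed \<open>p\<close>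
  while nodes and weights move.\<close>

definition moment_deriv :: "nat \<Rightarrow> (nat \<Rightarrow> real) \<Rightarrow> (nat \<Rightarrow> real) \<Rightarrow> (nat \<Rightarrow> real) \<Rightarrow> (nat \<Rightarrow> real) \<Rightarrow> real
  poly \<Rightarrow> real" where
  "moment_deriv n lam w lam' w' p = (\<Sum>j<n. w' j * poly p (lam j) + w j * poly (pderiv p) (lam j)
    * lam' j)"

lemma moment_deriv_jacobi_poly:
  fixes \<alpha> \<beta> lam w :: "nat \<Rightarrow> real \<Rightarrow> real"
  assumes d\<alpha>: "\<And>i. i < n \<Longrightarrow> (\<alpha> i has_real_derivative \<alpha>' i) (at t)"
    and d\<beta>: "\<And>i. Suc i < n \<Longrightarrow> (\<beta> i has_real_derivative \<beta>' i) (at t)"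
    and dlam: "\<And>j. j < n \<Longrightarrow> (lam j has_real_derivative lam' j) (at t)"
    and dw: "\<And>j. j < n \<Longrightarrow> (w j has_real_derivative w' j) (at t)"
    and nz: "\<And>i. Suc i < n \<Longrightarrow> \<beta> i t \<noteq> 0"
    and ev: "\<forall>\<^sub>F s in nhds t. \<forall>k<n. \<forall>l\<le>n.
      (\<Sum>j<n. w j s * poly (jacobi_poly (\<lambda>i. \<alpha> i s) (\<lambda>i. \<beta> i s) k) (lam j s)
        * poly (jacobi_poly (\<lambda>i. \<alpha> i s) (\<lambda>i. \<beta> i s) l) (lam j s)) =
      (if k = l then (offprod (\<lambda>i. \<beta> i s) k)\<^sup>2 else 0)"
    and k: "k < n"
  defines "P \<equiv> jacobi_poly (\<lambda>i. \<alpha> i t) (\<lambda>i. \<beta> i t)"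
    and "M \<equiv> moment_deriv n (\<lambda>j. lam j t) (\<lambda>j. w j t) lam' w'"
  shows "M (P k * P (Suc k)) = (offprod (\<lambda>i. \<beta> i t) k)\<^sup>2 * (\<Sum>i\<le>k. \<alpha>' i)" (is ?A)
    and "M (P k * P k) = (offprod (\<lambda>i. \<beta> i t) k)\<^sup>2 * (\<Sum>i<k. 2 * \<beta>' i / \<beta> i t)" (is ?B)
proof -
  let ?E = "jacobi_poly_deriv (\<lambda>i. \<alpha> i t) (\<lambda>i. \<beta> i t) \<alpha>' \<beta>'" and ?Q
    = "\<lambda>s. jacobi_poly (\<lambda>i. \<alpha> i s) (\<lambda>i. \<beta> i s)"
  define ip where "ip p r = (\<Sum>j<n. w j t * poly p (lam j t) * poly r (lam j t))" for p r
  have sym: "ip p r = ip r p" for p r unfolding ip_def by (intro sum.cong) auto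
  have orth: "ip (P k) (P l) = (if k = l then (offprod (\<lambda>i. \<beta> i t) k)\<^sup>2 else 0)" if "k < n" "l \<le> n"
    for k l
    using eventually_nhds_x_imp_x[OF ev] that by (simp add: ip_def P_def)
  have Pdeg: "degree (P k) = k" "coeff (P k) k = 1" for k by (simp_all add: P_def)
  have low: "ip p (P l) = 0" if "\<And>d. d \<ge> l \<Longrightarrow> coeff p d = 0" "l \<le> n" for p l
    unfolding ip_def
    by (rule pair_lower_degree[OF Pdeg _ that(1) order_refl]) (use orth that(2) in \<open>auto simp: ip_def\<close>)
  have lead: "ip p (P l) = coeff p l * (offprod (\<lambda>i. \<beta> i t) l)\<^sup>2" if "\<And>d. d > l \<Longrightarrow> coeff p d
    = 0" "l < n" for p l
  proof -
    have "ip p (P l) = coeff p l * ip (P l) (P l)"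
      unfolding ip_def
      by (rule pair_leading_coeff[OF Pdeg _ that(1)]) (use orth that(2) in \<open>auto simp: ip_def\<close>)
    then show ?thesis using orth[of l l] that(2) by simp
  qed
  have Elow: "ip (?E i) (P l) = 0" if "i \<le> l" "l \<le> n" for i l
    using that jacobi_poly_deriv_coeff[of i "\<lambda>i. \<alpha> i t" "\<lambda>i. \<beta> i t" \<alpha>' \<beta>'] by (intro low) auto
  have main: "((\<lambda>s. \<Sum>j<n. w j s * poly (?Q s k) (lam j s) * poly (?Q s l) (lam j s)) has_real_derivative
      M (P k * P l) + ip (?E k) (P l) + ip (?E l) (P k)) (at t)" if "k \<le> n" "l \<le> n" for k l
  proof -
    have "((\<lambda>s. w j s * poly (?Q s k) (lam j s) * poly (?Q s l) (lam j s)) has_real_derivative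
      w' j * poly (P k) (lam j t) * poly (P l) (lam j t)
      + w j t * (poly (pderiv (P k)) (lam j t) * lam' j + poly (?E k) (lam j t)) * poly (P l) (lam j t)
      + w j t * poly (P k) (lam j t) * (poly (pderiv (P l)) (lam j t) * lam' j
        + poly (?E l) (lam j t))) (at t)"
      if j: "j < n" for j
    proof -
      have "((\<lambda>s. poly (?Q s i) (lam j s)) has_real_derivative
        poly (pderiv (P i)) (lam j t) * lam' j + poly (?E i) (lam j t)) (at t)" if "i \<le> n" for i
        unfolding P_def using d\<alpha> d\<beta> dlam[OF j] that by (intro DERIV_poly_jacobi_poly) auto
      from DERIV_mult[OF DERIV_mult[OF dw[OF j] this[OF \<open>k \<le> n\<close>]] this[OF \<open>l \<le> n\<close>]]
      show ?thesis by (rule DERIV_cong) (simp add: P_def algebra_simps)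
    qed
    then have "((\<lambda>s. \<Sum>j<n. w j s * poly (?Q s k) (lam j s) * poly (?Q s l) (lam j s)) has_real_derivative
      (\<Sum>j<n. w' j * poly (P k) (lam j t) * poly (P l) (lam j t)
      + w j t * (poly (pderiv (P k)) (lam j t) * lam' j + poly (?E k) (lam j t)) * poly (P l) (lam j t)
      + w j t * poly (P k) (lam j t) * (poly (pderiv (P l)) (lam j t) * lam' j
        + poly (?E l) (lam j t)))) (at t)"
      by (intro DERIV_sum) auto
    also have "(\<Sum>j<n. w' j * poly (P k) (lam j t) * poly (P l) (lam j t)
      + w j t * (poly (pderiv (P k)) (lam j t) * lam' j + poly (?E k) (lam j t)) * poly (P l) (lam j t)
      + w j t * poly (P k) (lam j t) * (poly (pderiv (P l)) (lam j t) * lam' j + poly (?E l) (lam j t)))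
      = M (P k * P l) + ip (?E k) (P l) + ip (?E l) (P k)"
      unfolding M_def moment_deriv_def ip_def sum.distrib[symmetric]
      by (intro sum.cong) (auto simp: pderiv_mult algebra_simps)
    finally show ?thesis .
  qed
  have ev': "\<forall>\<^sub>F s in nhds t. (\<Sum>j<n. w j s * poly (?Q s k) (lam j s) * poly (?Q s l) (lam j s)) =
      (if k = l then (offprod (\<lambda>i. \<beta> i s) k)\<^sup>2 else 0)" if "l \<le> n" for l
    using ev by eventually_elim (use k that in auto)
  \<comment> \<open>Near \<open>t\<close> the pairing of degrees \<open>k\<close> and
    \<open>Suc k\<close> is constantly zero; the case \<open>Suc k = n\<close> is why the relations
    are assumed for \<open>l \<le> n\<close>.\<close>
  have "((\<lambda>s. 0) has_real_derivative M (P k * P (Suc k)) + ip (?E k) (P (Suc k))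
    + ip (?E (Suc k)) (P k)) (at t)"
    using main[of k "Suc k"] k DERIV_cong_ev[OF refl ev'[of "Suc k"] refl] by simp
  then have "M (P k * P (Suc k)) + ip (?E k) (P (Suc k)) + ip (?E (Suc k)) (P k) = 0"
    by (rule DERIV_unique) simp
  moreover have "ip (?E (Suc k)) (P k) = - (\<Sum>i<Suc k. \<alpha>' i) * (offprod (\<lambda>i. \<beta> i t) k)\<^sup>2"
    using jacobi_poly_deriv_coeff[of "Suc k" "\<lambda>i. \<alpha> i t" "\<lambda>i. \<beta> i t" \<alpha>' \<beta>'] k
    by (subst lead) (auto simp del: jacobi_poly_deriv.simps)
  ultimately show ?A using Elow[of k "Suc k"] k
    by (simp add: lessThan_Suc_atMost algebra_simps del: jacobi_poly_deriv.simps)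
  \<comment> \<open>On the diagonal both velocity pairings vanish, so the moment moves exactly like
    the squared norm.\<close>
  have "((\<lambda>s. (offprod (\<lambda>i. \<beta> i s) k)\<^sup>2) has_real_derivative M (P k * P k) + ip (?E k) (P k)
    + ip (?E k) (P k)) (at t)"
    using main[of k k] k DERIV_cong_ev[OF refl ev'[of k] refl] by simp
  moreover have "((\<lambda>s. (offprod (\<lambda>i. \<beta> i s) k)\<^sup>2) has_real_derivative
    (offprod (\<lambda>i. \<beta> i t) k)\<^sup>2 * (\<Sum>i<k. 2 * \<beta>' i / \<beta> i t)) (at t)"
    using k by (intro DERIV_offprod_square d\<beta> nz) auto
  ultimately show ?B using Elow[of k k] k DERIV_unique by fastforce
qed

section \<open>The value of the determinant\<close>

lemma prod_lessThan_add: "(\<Prod>i<n + m. f i) = (\<Prod>i<n. f i) * (\<Prod>i<m. f (n + i :: nat))"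
  for f :: "nat \<Rightarrow> 'a::comm_monoid_mult"
  by (induction m) (simp_all add: mult.assoc)

lemma sum_lessThan_add: "(\<Sum>i<n + m. f i) = (\<Sum>i<n. f i) + (\<Sum>i<m. f (n + i :: nat))"
  for f :: "nat \<Rightarrow> 'a::comm_monoid_add"
  by (induction m) (simp_all add: add.assoc)

text \<open>The functional attached to column \<open>c\<close>: the partial derivative of \<open>p \<mapsto> \<Sum>\<^sub>j q\<^sub>j\<^sup>2 p(\<lambda>\<^sub>j)\<close>
  with respect to the \<open>c\<close>-th spectral coordinate. The last weight is \<open>1\<close> minus the others,
  so these functionals vanish on constants.\<close>

definition moment_partial :: "nat \<Rightarrow> (nat \<Rightarrow> real) \<Rightarrow> (nat \<Rightarrow> real) \<Rightarrow> real poly \<Rightarrow> nat \<Rightarrow> real" where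
  "moment_partial n lam q p c = (if c < n then (q c)\<^sup>2 * poly (pderiv p) (lam c)
     else 2 * q (c - n) * (poly p (lam (c - n)) - poly p (lam (n - 1))))"

text \<open>The functionals are linear and annihilate constants, so the expansion starts with the
  first power.\<close>

lemma moment_partial_expand:
  assumes deg: "degree p \<le> N"
  shows "moment_partial n lam q p c =
    (\<Sum>d<N. coeff p (Suc d) * moment_partial n lam q (Polynomial.monom 1 (Suc d)) c)"
proof -
  have v: "poly p x = coeff p 0 + (\<Sum>d<N. coeff p (Suc d) * x ^ Suc d)" for x
    using poly_eq_sum_lessThan[of "Suc N" p x] deg
    by (simp add: sum.lessThan_Suc_shift coeff_eq_0 del: sum.lessThan_Suc)
  have dv: "poly (pderiv p) x = (\<Sum>d<N. coeff p (Suc d) * (real (Suc d) * x ^ d))" for x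
    using poly_eq_sum_lessThan[of N "pderiv p" x] deg
    by (simp add: coeff_pderiv coeff_eq_0 mult.assoc mult.left_commute mult.commute)
  show ?thesis
  proof (cases "c < n")
    case True
    then show ?thesis
      by (simp add: moment_partial_def dv pderiv_monom poly_monom sum_distrib_left algebra_simps)
  next
    case False
    have d: "poly p x - poly p y = (\<Sum>d<N. coeff p (Suc d) * (x ^ Suc d - y ^ Suc d))" for x y
      unfolding v[of x] v[of y] by (simp add: sum_subtractf right_diff_distrib)
    show ?thesis using False
      by (simp add: moment_partial_def d poly_monom sum_distrib_left mult.assoc mult.left_commute)
  qed
qed

text \<open>Monic systems of degrees \<open>1, ..., N\<close> in any order differ by unitriangular
  row changes. This allows the system natural for the matrix entries to be exchanged for one whose
  determinant can be computed.\<close>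

lemma abs_fdet_moment_partial:
  assumes s: "s permutes {0..<N}"
    and R: "\<And>r. r < N \<Longrightarrow> degree (R r) = Suc (s r) \<and> lead_coeff (R r) = 1"
  shows "\<bar>fdet N (\<lambda>r c. moment_partial n lam q (R r) c)\<bar> =
    \<bar>fdet N (\<lambda>d c. moment_partial n lam q (Polynomial.monom 1 (Suc d)) c)\<bar>"
proof -
  have "fdet N (\<lambda>r c. moment_partial n lam q (R r) c) =
    fdet N (\<lambda>r c. \<Sum>d<N. coeff (R r) (Suc d) * moment_partial n lam q (Polynomial.monom 1 (Suc d)) c)"
  proof (intro fdet_cong moment_partial_expand)
    fix r assume "r < N"
    then show "degree (R r) \<le> N" using R[of r] permutes_in_image[OF s, of r] by auto
  qed
  also have "\<bar>\<dots>\<bar> = \<bar>fdet N (\<lambda>d c. moment_partial n lam q (Polynomial.monom 1 (Suc d)) c)\<bar>"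
  proof (rule abs_fdet_unitriangular[OF s])
    show "coeff (R r) (Suc (s r)) = 1" if "r < N" for r using R[OF that] by metis
    show "coeff (R r) (Suc d) = 0" if "r < N" "s r < d" for r d using R[OF that(1)] that(2)
      by (intro coeff_eq_0) simp
  qed
  finally show ?thesis .
qed

text \<open>Subtracting the last column from the others turns the row of \<open>P 0\<close> into
  zeros and a final 1; expansion along it leaves the smaller determinant.\<close>

lemma abs_fdet_difference_columns:
  fixes lam :: "nat \<Rightarrow> real" and P :: "nat \<Rightarrow> real poly"
  assumes n: "n \<ge> 1" and P0: "P 0 = 1"
  shows "\<bar>fdet (n - 1) (\<lambda>i j. poly (P (Suc i)) (lam j) - poly (P (Suc i)) (lam (n - 1)))\<bar>
    = \<bar>fdet n (\<lambda>i j. poly (P i) (lam j))\<bar>"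
proof -
  obtain m where m: "n = Suc m" using n by (cases n) auto
  let ?W = "\<lambda>i j. poly (P i) (lam j)"
  \<comment> \<open>Multiplication by \<open>?K\<close> performs the column subtraction.\<close>
  let ?K = "\<lambda>i j. if i = j then 1 else if i = m then - 1 else (0::real)"
  let ?F = "\<lambda>i j. if j < m then ?W i j - ?W i m else ?W i m"
  have "fdet n ?W * fdet n ?K = fdet n ?F"
    unfolding fdet_mult
  proof (rule fdet_cong)
    fix i j assume j: "j < n"
    show "(\<Sum>k<n. ?W i k * ?K k j) = ?F i j"
    proof (cases "j < m")
      case True
      have "(\<Sum>k<n. ?W i k * ?K k j) = (\<Sum>k<m. ?W i k * ?K k j) - ?W i m"
        using True by (simp add: m)
      also have "(\<Sum>k<m. ?W i k * ?K k j) = (\<Sum>k<m. if k = j then ?W i k else 0)"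
        by (intro sum.cong) auto
      finally show ?thesis using True by simp
    next
      case False
      then have "j = m" using j m by simp
      have "(\<Sum>k<n. ?W i k * ?K k j) = (\<Sum>k<m. ?W i k * ?K k j) + ?W i m"
        using \<open>j = m\<close> by (simp add: m)
      also have "(\<Sum>k<m. ?W i k * ?K k j) = 0"
        using \<open>j = m\<close> by (intro sum.neutral) auto
      finally show ?thesis using \<open>j = m\<close> by simp
    qed
  qed
  moreover have "fdet n ?K = 1" by (subst fdet_lower) (auto simp: m)
  moreover have "fdet (Suc m) ?F = (- 1) ^ m * ?F 0 m * fdet m (\<lambda>i j. ?F (Suc i) j)"
    by (rule fdet_first_row_last) (simp add: P0)
  moreover have "fdet m (\<lambda>i j. ?F (Suc i) j) = fdet m (\<lambda>i j. ?W (Suc i) j - ?W (Suc i) m)"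
    by (rule fdet_cong) simp
  ultimately show ?thesis by (simp add: m P0 abs_mult power_abs)
qed

text \<open>\<open>R\<close> lists the products from the differentiated relations, of degrees
  \<open>1, 3, ..., 2n - 1\<close> and then \<open>2, 4, ..., 2n - 2\<close>. It is traded for
  \<open>Q\<close>, of degrees \<open>n, ..., 2n - 1\<close> and then \<open>1, ..., n - 1\<close>,
  which is block triangular.\<close>

lemma abs_fdet_moment_partial_jacobi_poly:
  fixes \<alpha> \<beta> :: "nat \<Rightarrow> real"
  assumes s: "jacobi_spec n \<alpha> \<beta> lam q" and n: "n \<ge> 1"
  defines "P \<equiv> jacobi_poly \<alpha> \<beta>"
  defines "R \<equiv> \<lambda>r. if r < n then P r * P (Suc r) else P (Suc (r - n)) * P (Suc (r - n))"
  shows "\<bar>fdet (2 * n - 1) (\<lambda>r c. moment_partial n lam q (R r) c)\<bar> =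
    2 ^ (n - 1) * (\<Prod>j<n - 1. q j) * (\<Prod>r<n. (offprod \<beta> r)\<^sup>2)\<^sup>2 / (\<Prod>j<n. (q j)\<^sup>2)"
proof -
  let ?N = "2 * n - 1" and ?L = "moment_partial n lam q"
  have N: "?N = n + (n - 1)" using n by simp
  have Pdeg: "degree (P k) = k" and Plead: "coeff (P k) k = 1" for k by (simp_all add: P_def)
  have mul: "degree (P i * P j) = i + j \<and> lead_coeff (P i * P j) = 1" for i j
  proof -
    have "P i \<noteq> 0" "P j \<noteq> 0" by (simp_all add: P_def)
    then show ?thesis by (simp add: degree_mult_eq Pdeg lead_coeff_mult Plead
      coeff_mult_degree_sum[of "P i" "P j", unfolded Pdeg])
  qed
  define Q where "Q r = (if r < n then P r * P n else P (Suc (r - n)))" for r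
  \<comment> \<open>Below \<open>?N\<close>, \<open>s1\<close> and \<open>s2\<close> are one less
    than the degrees of \<open>R r\<close> and \<open>Q r\<close>; \<open>t1\<close> and
    \<open>t2\<close> are their inverses.\<close>
  define s1 where "s1 r = (if r < n then 2 * r else if r < ?N then 2 * (r - n) + 1 else r)" for r
  define t1 where "t1 d = (if d < ?N then if even d then d div 2 else n + d div 2 else d)" for d
  define s2 where "s2 r = (if r < n then r + (n - 1) else if r < ?N then r - n else r)" for r
  define t2 where "t2 d = (if d < n - 1 then d + n else if d < ?N then d - (n - 1) else d)" for d
  have s1: "s1 permutes {0..<?N}"
    by (rule bij_imp_permutes, rule bij_betw_byWitness[where f' = t1])
      (auto simp: s1_def t1_def elim!: evenE oddE)
  have s2: "s2 permutes {0..<?N}"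
    by (rule bij_imp_permutes, rule bij_betw_byWitness[where f' = t2]) (auto simp: s2_def t2_def)
  have "degree (R r) = Suc (s1 r) \<and> lead_coeff (R r) = 1" if "r < ?N" for r
    using that mul[of r "Suc r"] mul[of "Suc (r - n)" "Suc (r - n)"] by (auto simp: R_def s1_def)
  then have "\<bar>fdet ?N (\<lambda>r c. ?L (R r) c)\<bar> = \<bar>fdet ?N (\<lambda>d c. ?L (Polynomial.monom 1 (Suc d)) c)\<bar>"
    by (rule abs_fdet_moment_partial[OF s1])
  also have "\<dots> = \<bar>fdet ?N (\<lambda>r c. ?L (Q r) c)\<bar>"
  proof (rule abs_fdet_moment_partial[OF s2, symmetric])
    fix r assume "r < ?N"
    then show "degree (Q r) = Suc (s2 r) \<and> lead_coeff (Q r) = 1"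
      using mul[of r n] n by (auto simp: Q_def s2_def Pdeg Plead)
  qed
  finally have RQ: "\<bar>fdet ?N (\<lambda>r c. ?L (R r) c)\<bar> = \<bar>fdet ?N (\<lambda>r c. ?L (Q r) c)\<bar>" .
  have root: "poly (P n) (lam j) = 0" if "j < n" for j using s that by (simp add: jacobi_spec_def P_def)
  define W where "W = fdet n (\<lambda>i j. poly (P i) (lam j))"
  \<comment> \<open>Multiples of \<open>P n\<close> vanish at all nodes, so their entries in the
    weight columns are zero.\<close>
  have block: "fdet ?N (\<lambda>r c. ?L (Q r) c) = fdet n (\<lambda>r c. ?L (Q r) c) * fdet (n - 1) (\<lambda>i j. ?L (Q (n
    + i)) (n + j))"
    unfolding N by (rule fdet_block_upper_right_zero) (auto simp: Q_def moment_partial_def root)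
  \<comment> \<open>At a root of \<open>P n\<close> the product rule leaves only the term with
    \<open>pderiv (P n)\<close>, which merely scales a column.\<close>
  have "fdet n (\<lambda>r c. ?L (Q r) c) = fdet n (\<lambda>i j. poly (P i) (lam j) * ((q j)\<^sup>2
    * poly (pderiv (P n)) (lam j)))"
    by (rule fdet_cong) (auto simp: Q_def moment_partial_def root pderiv_mult)
  also have "\<dots> = W * (\<Prod>j<n. (q j)\<^sup>2 * poly (pderiv (P n)) (lam j))"
    unfolding W_def by (rule fdet_scale_cols)
  finally have b1: "fdet n (\<lambda>r c. ?L (Q r) c) = W * (\<Prod>j<n. (q j)\<^sup>2)
    * (\<Prod>j<n. poly (pderiv (P n)) (lam j))"
    by (simp add: prod.distrib mult.assoc)
  have "fdet (n - 1) (\<lambda>i j. ?L (Q (n + i)) (n + j)) =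
    fdet (n - 1) (\<lambda>i j. (poly (P (Suc i)) (lam j) - poly (P (Suc i)) (lam (n - 1))) * (2 * q j))"
    by (rule fdet_cong) (simp add: Q_def moment_partial_def)
  also have "\<dots> = fdet (n - 1) (\<lambda>i j. poly (P (Suc i)) (lam j) - poly (P (Suc i)) (lam (n - 1)))
    * (\<Prod>j<n - 1. 2 * q j)"
    by (rule fdet_scale_cols)
  finally have e: "fdet (n - 1) (\<lambda>i j. ?L (Q (n + i)) (n + j)) =
    fdet (n - 1) (\<lambda>i j. poly (P (Suc i)) (lam j) - poly (P (Suc i)) (lam (n - 1))) * (\<Prod>j<n - 1. 2
      * q j)" .
  have b2: "\<bar>fdet (n - 1) (\<lambda>i j. ?L (Q (n + i)) (n + j))\<bar> = \<bar>W\<bar> * \<bar>\<Prod>j<n - 1. 2 * q j\<bar>"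
    unfolding e abs_mult W_def by (subst abs_fdet_difference_columns[OF n]) (simp_all add: P_def)
  have q: "q j > 0" if "j < n" for j using s that by (simp add: jacobi_spec_def)
  have "\<bar>\<Prod>j<n - 1. 2 * q j\<bar> = (\<Prod>j<n - 1. 2 * q j)"
    using q by (intro abs_of_nonneg prod_nonneg) (simp add: less_imp_le)
  also have "\<dots> = 2 ^ (n - 1) * (\<Prod>j<n - 1. q j)" by (simp add: prod.distrib)
  finally have q2: "\<bar>\<Prod>j<n - 1. 2 * q j\<bar> = 2 ^ (n - 1) * (\<Prod>j<n - 1. q j)" .
  have "\<bar>W\<bar> = \<bar>fdet n (\<lambda>k j. lam j ^ k)\<bar>"
    unfolding W_def by (rule abs_fdet_monic_values[OF permutes_id]) (simp add: Pdeg Plead)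
  then have W2: "W\<^sup>2 = (fdet n (\<lambda>k j. lam j ^ k))\<^sup>2" by (metis power2_abs)
  have chi: "\<bar>\<Prod>j<n. poly (pderiv (P n)) (lam j)\<bar> = W\<^sup>2"
    unfolding W2 by (rule abs_prod_pderiv_roots) (simp_all add: Pdeg Plead root jacobi_spec_inj[OF s])
  define w where "w = (\<Prod>j<n. (q j)\<^sup>2)"
  define H where "H = (\<Prod>r<n. (offprod \<beta> r)\<^sup>2)"
  have wpos: "w > 0" unfolding w_def using q by (intro prod_pos) (simp add: less_imp_neq[symmetric])
  \<comment> \<open>Gram matrix: evaluations times weights times transposed evaluations is diagonal
    by orthogonality.\<close>
  have "W * w * W = fdet n (\<lambda>i k. poly (P i) (lam k) * (q k)\<^sup>2) * fdet n (\<lambda>k j. poly (P j) (lam k))"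
    unfolding W_def w_def fdet_scale_cols fdet_transpose[of n "\<lambda>k j. poly (P k) (lam j)"] ..
  also have "\<dots> = fdet n (\<lambda>i j. if i = j then (offprod \<beta> i)\<^sup>2 else 0)"
    unfolding fdet_mult
  proof (rule fdet_cong)
    fix i j assume "i < n" "j < n"
    from jacobi_spec_orthonormal[OF s this]
    show "(\<Sum>k<n. poly (P i) (lam k) * (q k)\<^sup>2 * poly (P j) (lam k)) = (if i
      = j then (offprod \<beta> i)\<^sup>2 else 0)"
      by (simp add: P_def mult.commute mult.left_commute)
  qed
  also have "\<dots> = H" unfolding H_def by (subst fdet_lower) auto
  finally have WH: "W\<^sup>2 * w = H" by (simp add: power2_eq_square mult_ac)
  have "\<bar>fdet ?N (\<lambda>r c. ?L (R r) c)\<bar> = \<bar>W\<bar> * w * W\<^sup>2 * (\<bar>W\<bar> * (2 ^ (n - 1) * (\<Prod>j<n - 1. q j)))"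
    unfolding RQ block abs_mult b2 q2 unfolding b1 abs_mult chi w_def[symmetric] using wpos by simp
  \<comment> \<open>The four factors \<open>W\<close> are absorbed by two copies of
    \<open>W\<^sup>2 * w\<close>, at the price of one division by \<open>w\<close>.\<close>
  also have "\<dots> = 2 ^ (n - 1) * (\<Prod>j<n - 1. q j) * ((W\<^sup>2 * w) * (W\<^sup>2 * w)) / w"
    using wpos by (simp add: field_simps power2_eq_square flip: abs_mult)
  finally show ?thesis unfolding WH by (simp add: H_def w_def power2_eq_square)
qed

text \<open>Row \<open>i < n\<close> of \<open>D\<close> stands for the derivatives of
  \<open>\<alpha> i\<close>, row \<open>n + i\<close> for those of \<open>\<beta> i\<close>. The
  hypotheses are a triangular system for \<open>D\<close> whose coefficient determinant and
  right-hand determinant are both known; squared norms and powers of 2 cancel in the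
  quotient.\<close>

lemma jacobian_value:
  fixes \<alpha> \<beta> :: "nat \<Rightarrow> real" and D :: "nat \<Rightarrow> nat \<Rightarrow> real"
  assumes s: "jacobi_spec n \<alpha> \<beta> lam q" and n: "n \<ge> 1"
  defines "P \<equiv> jacobi_poly \<alpha> \<beta>"
  assumes diag: "\<And>r c. r < n \<Longrightarrow> c < 2 * n - 1 \<Longrightarrow>
      moment_partial n lam q (P r * P (Suc r)) c = (offprod \<beta> r)\<^sup>2 * (\<Sum>i\<le>r. D i c)"
    and off: "\<And>r c. r < n \<Longrightarrow> c < 2 * n - 1 \<Longrightarrow>
      moment_partial n lam q (P r * P r) c = (offprod \<beta> r)\<^sup>2 * (\<Sum>i<r. 2 * D (n + i) c / \<beta> i)"
  shows "\<bar>fdet (2 * n - 1) D\<bar> = 1 / q (n - 1) * ((\<Prod>i<n - 1. \<beta> i) / (\<Prod>i<n. q i))"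
proof -
  let ?N = "2 * n - 1" and ?L = "moment_partial n lam q" and ?h = "\<lambda>r. (offprod \<beta> r)\<^sup>2"
  have N: "?N = n + (n - 1)" using n by simp
  have \<beta>: "\<beta> i > 0" if "i < n - 1" for i using s that by (simp add: jacobi_spec_def)
  have q: "q j > 0" if "j < n" for j using s that by (simp add: jacobi_spec_def)
  define A where "A r k = (if r < n then if k \<le> r then ?h r else 0
    else if k < n then 0 else if k - n \<le> r - n then 2 * ?h (Suc (r - n)) / \<beta> (k - n) else 0)" for r k
  \<comment> \<open>The squares start at \<open>P 1\<close>, since the relation for
    \<open>P 0 * P 0\<close> reads \<open>0 = 0\<close>.\<close>
  define R where "R r = (if r < n then P r * P (Suc r) else P (Suc (r - n)) * P (Suc (r - n)))" for r
  have "fdet ?N A * fdet ?N D = fdet ?N (\<lambda>r c. ?L (R r) c)"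
    unfolding fdet_mult
  proof (rule fdet_cong)
    fix r c assume r: "r < ?N" and c: "c < ?N"
    have split: "(\<Sum>k<?N. A r k * D k c) = (\<Sum>k<n. A r k * D k c) + (\<Sum>k<n - 1. A r (n + k) * D (n + k) c)"
      unfolding N by (rule sum_lessThan_add)
    show "(\<Sum>k<?N. A r k * D k c) = ?L (R r) c"
    proof (cases "r < n")
      case True
      have "(\<Sum>k<n - 1. A r (n + k) * D (n + k) c) = 0" using True
        by (intro sum.neutral) (auto simp: A_def)
      moreover have "(\<Sum>k<n. A r k * D k c) = (\<Sum>k\<le>r. A r k * D k c)"
        using True by (intro sum.mono_neutral_right) (auto simp: A_def)
      moreover have "\<dots> = ?h r * (\<Sum>k\<le>r. D k c)"
        unfolding sum_distrib_left using True by (intro sum.cong) (auto simp: A_def)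
      ultimately show ?thesis using diag[OF True c] True unfolding split by (simp add: R_def)
    next
      case False
      define i where "i = r - n"
      have i: "Suc i < n" "r = n + i" using False r by (auto simp: i_def)
      have "(\<Sum>k<n. A r k * D k c) = 0" using False by (intro sum.neutral) (auto simp: A_def)
      moreover have "(\<Sum>k<n - 1. A r (n + k) * D (n + k) c) = (\<Sum>k<Suc i. A r (n + k) * D (n + k) c)"
        using i by (intro sum.mono_neutral_right) (auto simp: A_def)
      moreover have "\<dots> = ?h (Suc i) * (\<Sum>k<Suc i. 2 * D (n + k) c / \<beta> k)"
        unfolding sum_distrib_left using i by (intro sum.cong) (auto simp: A_def)
      ultimately show ?thesis using off[OF i(1) c] i unfolding split by (simp add: R_def)
    qed
  qed
  then have AD: "\<bar>fdet ?N A\<bar> * \<bar>fdet ?N D\<bar> =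
     2 ^ (n - 1) * (\<Prod>j<n - 1. q j) * (\<Prod>r<n. ?h r)\<^sup>2 / (\<Prod>j<n. (q j)\<^sup>2)"
    using abs_fdet_moment_partial_jacobi_poly[OF s n] unfolding R_def P_def by (simp flip: abs_mult)
  have "fdet ?N A = (\<Prod>r<?N. A r r)" by (rule fdet_lower) (auto simp: A_def)
  also have "\<dots> = (\<Prod>r<n. ?h r) * (\<Prod>i<n - 1. 2 * ?h (Suc i) / \<beta> i)"
    unfolding N prod_lessThan_add by (intro arg_cong2[where f = "(*)"] prod.cong) (auto simp: A_def)
  also have "(\<Prod>i<n - 1. 2 * ?h (Suc i) / \<beta> i) = 2 ^ (n - 1) * (\<Prod>i<n - 1. ?h (Suc i)) / (\<Prod>i<n - 1. \<beta> i)"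
    by (simp add: prod_dividef prod.distrib)
  \<comment> \<open>The additional factor \<open>?h 0\<close> is 1.\<close>
  also have "(\<Prod>i<n - 1. ?h (Suc i)) = (\<Prod>r<n. ?h r)"
  proof -
    obtain m where m: "n = Suc m" using n by (cases n) auto
    show ?thesis unfolding m by (simp add: prod.lessThan_Suc_shift del: prod.lessThan_Suc
      offprod_simps(2))
  qed
  finally have A: "fdet ?N A = 2 ^ (n - 1) * (\<Prod>r<n. ?h r)\<^sup>2 / (\<Prod>i<n - 1. \<beta> i)"
    by (simp add: power2_eq_square)
  define H where "H = (\<Prod>r<n. ?h r)"
  have H: "H > 0" unfolding H_def using jacobi_spec_offprod_pos[OF s]
    by (intro prod_pos) (simp add: less_imp_neq[symmetric])
  have b: "(\<Prod>i<n - 1. \<beta> i) > 0" using \<beta> by (intro prod_pos) auto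
  have qn: "(\<Prod>i<n. q i) = (\<Prod>i<n - 1. q i) * q (n - 1)"
  proof -
    obtain m where m: "n = Suc m" using n by (cases n) auto
    show ?thesis unfolding m by simp
  qed
  have q1: "(\<Prod>i<n - 1. q i) > 0" using q by (intro prod_pos) auto
  have q0: "q (n - 1) > 0" using q n by simp
  have E: "2 ^ (n - 1) * H\<^sup>2 / (\<Prod>i<n - 1. \<beta> i) * \<bar>fdet ?N D\<bar> =
     2 ^ (n - 1) * (\<Prod>j<n - 1. q j) * H\<^sup>2 / (\<Prod>j<n. q j)\<^sup>2"
    using AD b H unfolding A H_def[symmetric] by (simp add: prod_power_distrib)
  have aux: "x = 1 / y * (b / (z * y))"
    if "c * h / b * x = c * z * h / (z * y)\<^sup>2" "c > 0" "h > 0" "b > 0" "z > 0" "y > 0"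
      for x y z b c h :: real
    using that by (simp add: field_simps power2_eq_square)
  show ?thesis
    unfolding qn by (rule aux[OF E[unfolded qn]]) (use b H q0 q1 in auto)
qed

section \<open>The spectral map\<close>

lemma jacobi_spec_cong:
  assumes "\<And>i. i < n \<Longrightarrow> \<alpha> i = \<alpha>' i" "\<And>i. i < n - 1 \<Longrightarrow> \<beta> i = \<beta>' i"
    "\<And>j. j < n \<Longrightarrow> lam j = lam' j" "\<And>j. j < n \<Longrightarrow> q j = q' j"
  shows "jacobi_spec n \<alpha> \<beta> lam q \<longleftrightarrow> jacobi_spec n \<alpha>' \<beta>' lam' q'"
proof -
  have P: "jacobi_poly \<alpha> \<beta> k = jacobi_poly \<alpha>' \<beta>' k" if "k \<le> n" for k
    using assms(1,2) that by (intro jacobi_poly_cong) auto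
  have h: "offprod \<beta> k = offprod \<beta>' k" if "k < n" for k
    unfolding offprod_def using assms(2) that by (intro prod.cong) auto
  have "(\<Sum>k<n. (poly (jacobi_poly \<alpha> \<beta> k) (lam j))\<^sup>2 / (offprod \<beta> k)\<^sup>2) =
    (\<Sum>k<n. (poly (jacobi_poly \<alpha>' \<beta>' k) (lam' j))\<^sup>2 / (offprod \<beta>' k)\<^sup>2)" if "j < n" for j
    using assms(3)[OF that] by (intro sum.cong) (simp_all add: P h)
  then show ?thesis
    unfolding jacobi_spec_def using assms(2-4) P[of n] by (auto simp: less_trans)
qed

text \<open>In these coordinates the matrix has diagonal \<open>coord e x 0, \<dots>, coord e x (n - 1)\<close> and
  off-diagonal \<open>coord e x n, \<dots>, coord e x (2 n - 2)\<close>, both from top to bottom.\<close>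

definition coord :: "(nat \<Rightarrow> 'd) \<Rightarrow> real ^ 'd \<Rightarrow> nat \<Rightarrow> real" where
  "coord e x p = vec_nth x (e p)"

text \<open>The last first component is not a coordinate, so its square is supplied by the unit
  sum.\<close>

definition weight :: "nat \<Rightarrow> (nat \<Rightarrow> 'd) \<Rightarrow> real ^ 'd \<Rightarrow> nat \<Rightarrow> real" where
  "weight n e y j = (if j < n - 1 then (coord e y (n + j))\<^sup>2 else 1 - (\<Sum>i<n - 1. (coord e y (n + i))\<^sup>2))"

text \<open>Explicit candidate for the inverse of the spectral map.\<close>

definition lanczos_map :: "nat \<Rightarrow> (nat \<Rightarrow> 'd) \<Rightarrow> real ^ 'd \<Rightarrow> real ^ 'd" where
  "lanczos_map n e y = (\<chi> i. let p = inv_into {..<2 * n - 1} e i in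
     if p < n then lanczos_alpha n (coord e y) (weight n e y) p else lanczos_beta n (coord e y)
       (weight n e y) (p - n))"

lemma sum_weight: "n \<ge> 1 \<Longrightarrow> (\<Sum>j<n. weight n e y j) = 1"
proof -
  assume "n \<ge> 1"
  then obtain m where m: "n = Suc m" by (cases n) auto
  show ?thesis by (simp add: weight_def m)
qed

text \<open>\<open>lam'\<close> and \<open>w'\<close> are the velocities when only coordinate
  \<open>c\<close> moves, at unit speed. A moving weight is compensated by the last one, which
  produces the difference of values in \<open>moment_partial\<close>.\<close>

lemma moment_deriv_unit:
  fixes n :: nat
  assumes n: "n \<ge> 1" and c: "c < 2 * n - 1"
    and lam': "\<And>j. j < n \<Longrightarrow> lam' j = (if j = c then 1 else 0)"
    and w: "\<And>j. j < n \<Longrightarrow> w j = (q j)\<^sup>2"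
    and w': "\<And>j. j < n \<Longrightarrow> w' j = (if j < n - 1 then 2 * q j * (if n + j = c then 1 else 0)
       else - (\<Sum>i<n - 1. 2 * q i * (if n + i = c then 1 else 0)))"
  shows "moment_deriv n lam w lam' w' p = moment_partial n lam q p c"
proof (cases "c < n")
  case True
  have "moment_deriv n lam w lam' w' p = (\<Sum>j<n. if j = c then (q c)\<^sup>2 * poly (pderiv p) (lam c) else 0)"
    unfolding moment_deriv_def using True by (intro sum.cong) (auto simp: lam' w w')
  then show ?thesis using True by (simp add: moment_partial_def)
next
  case False
  define m where "m = c - n"
  have m: "c = n + m" "m < n - 1" using False c by (auto simp: m_def)
  obtain k where k: "n = Suc k" using n by (cases n) auto
  have "(\<Sum>i<n - 1. 2 * q i * (if n + i = c then 1 else 0)) = (\<Sum>i<n - 1. if i = m then 2 * q m else 0)"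
    using m by (intro sum.cong) auto
  then have s: "(\<Sum>i<n - 1. 2 * q i * (if n + i = c then 1 else 0)) = 2 * q m" using m by simp
  have "moment_deriv n lam w lam' w' p = (\<Sum>j<n. w' j * poly p (lam j))"
    unfolding moment_deriv_def using m by (intro sum.cong) (auto simp: lam')
  also have "\<dots> = (\<Sum>j<k. w' j * poly p (lam j)) + w' k * poly p (lam k)" by (simp add: k)
  also have "(\<Sum>j<k. w' j * poly p (lam j)) = (\<Sum>j<k. if j = m then 2 * q m * poly p (lam m) else 0)"
    using m by (intro sum.cong) (auto simp: w' k)
  also have "\<dots> = 2 * q m * poly p (lam m)" using m k by simp
  also have "w' k = - 2 * q m" using w'[of k] s by (simp add: k)
  finally show ?thesis using False by (simp add: moment_partial_def m_def k algebra_simps)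
qed

context
  fixes n :: nat and e :: "nat \<Rightarrow> 'd::finite"
  assumes n: "n \<ge> 1" and e: "bij_betw e {..<2 * n - 1} (UNIV :: 'd set)"
begin

section \<open>Coordinates and the two domains\<close>

lemma inv_enum: "p < 2 * n - 1 \<Longrightarrow> inv_into {..<2 * n - 1} e (e p) = p"
  using e by (intro inv_into_f_f) (auto simp: bij_betw_def)

lemma enum_eq_iff: "p < 2 * n - 1 \<Longrightarrow> p' < 2 * n - 1 \<Longrightarrow> e p = e p' \<longleftrightarrow> p = p'"
  using e by (auto simp: bij_betw_def inj_on_def)

lemma enum_cases: obtains p where "p < 2 * n - 1" "i = e p"
  using e by (auto simp: bij_betw_def)

lemma vec_eq_coordI:
  assumes "\<And>p. p < 2 * n - 1 \<Longrightarrow> coord e x p = coord e x' p"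
  shows "x = x'"
proof (rule Finite_Cartesian_Product.vec_eq_iff[THEN iffD2], rule allI)
  fix i show "x $ i = x' $ i" by (rule enum_cases[of i]) (use assms in \<open>auto simp: coord_def\<close>)
qed

lemma coord_lanczos_map:
  "p < n \<Longrightarrow> coord e (lanczos_map n e y) p = lanczos_alpha n (coord e y) (weight n e y) p"
  "p < n - 1 \<Longrightarrow> coord e (lanczos_map n e y) (n + p) = lanczos_beta n (coord e y) (weight n e y) p"
  using n by (simp_all add: coord_def lanczos_map_def Let_def inv_enum[unfolded One_nat_def])

lemma matrix_domain_iff: "x \<in> matrix_domain n e \<longleftrightarrow> (\<forall>i<n - 1. coord e x (n + i) > 0)"
proof
  assume x: "x \<in> matrix_domain n e"
  show "\<forall>i<n - 1. coord e x (n + i) > 0"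
  proof (intro allI impI)
    fix i assume i: "i < n - 1"
    then have "coord_b n e x (n - 1 - i) > 0" using x by (auto simp: matrix_domain_def)
    then show "coord e x (n + i) > 0" using i by (simp add: coord_b_def coord_def)
  qed
next
  assume "\<forall>i<n - 1. coord e x (n + i) > 0"
  then have "coord_b n e x j > 0" if "j \<in> {1..<n}" for j
    using that by (auto simp: coord_b_def coord_def simp del: diff_diff_left)
  then show "x \<in> matrix_domain n e" by (simp add: matrix_domain_def)
qed

lemma jacobi_spec_coord:
  "jacobi_spec n (diag_seq n (coord_a n e x)) (off_seq n (coord_b n e x)) lam q \<longleftrightarrow>
   jacobi_spec n (coord e x) (\<lambda>i. coord e x (n + i)) lam q"
  by (rule jacobi_spec_cong) (auto simp: diag_seq_def off_seq_def coord_a_def coord_b_def coord_def)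

lemma coord_spectral_map:
  assumes s: "jacobi_spec n (coord e x) (\<lambda>i. coord e x (n + i)) lam q"
  shows "j < n \<Longrightarrow> coord e (spectral_map n e x) j = lam j"
    and "j < n - 1 \<Longrightarrow> coord e (spectral_map n e x) (n + j) = q j"
  using jacobi_spec_eigval[OF s[folded jacobi_spec_coord] n] jacobi_spec_first_comp[OF s[folded
    jacobi_spec_coord] n]
  using n by (simp_all add: coord_def spectral_map_def Let_def inv_enum[unfolded One_nat_def]
    tridiag_of_def)

lemma spectral_domain_iff:
  "y \<in> spectral_domain n e \<longleftrightarrow> (\<forall>k<n - 1. coord e y (Suc k) < coord e y k) \<and>
     (\<forall>k<n - 1. coord e y (n + k) > 0) \<and> (\<Sum>k<n - 1. (coord e y (n + k))\<^sup>2) < 1"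
proof -
  have all: "(\<forall>k\<in>{1..<n}. Q (k - 1)) \<longleftrightarrow> (\<forall>k<n - 1. Q k)" for Q
  proof safe
    fix k assume a: "\<forall>k\<in>{1..<n}. Q (k - 1)" and k: "k < n - 1"
    from bspec[OF a, of "Suc k"] k show "Q k" by simp
  qed auto
  have "(\<Sum>k\<in>{1..<n}. (coord_q n e y k)\<^sup>2) = (\<Sum>k<n - 1. (coord e y (n + k))\<^sup>2)"
    by (rule sum.reindex_bij_witness[where i = Suc and j = "\<lambda>k. k
      - 1"]) (auto simp: coord_q_def coord_def)
  moreover have "(\<forall>k\<in>{1..<n}. coord_lambda n e y k > coord_lambda n e y (k + 1)) \<longleftrightarrow> (\<forall>k<n
    - 1. coord e y (Suc k) < coord e y k)"
    using all[of "\<lambda>k. coord e y (Suc k) < coord e y k"] by (simp add: coord_lambda_def coord_def)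
  moreover have "(\<forall>k\<in>{1..<n}. coord_q n e y k > 0) \<longleftrightarrow> (\<forall>k<n - 1. coord e y (n + k) > 0)"
    using all[of "\<lambda>k. coord e y (n + k) > 0"] by (simp add: coord_q_def coord_def)
  ultimately show ?thesis by (simp add: spectral_domain_def)
qed

lemma continuous_coord: "continuous_on UNIV (\<lambda>y. coord e y p)"
  unfolding coord_def by (intro continuous_intros)

text \<open>Openness keeps short coordinate lines inside the domain and makes the inverse agree with
  \<open>lanczos_map\<close> on a neighbourhood.\<close>

lemma open_spectral_domain: "open (spectral_domain n e)"
proof -
  have "spectral_domain n e = (\<Inter>k\<in>{..<n - 1}. {y. coord e y (Suc k) < coord e y k}) \<inter>
    (\<Inter>k\<in>{..<n - 1}. {y. 0 < coord e y (n + k)}) \<inter> {y. (\<Sum>k<n - 1. (coord e y (n + k))\<^sup>2) < 1}"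
    by (auto simp: spectral_domain_iff)
  also have "open \<dots>"
    by (intro open_Int open_INT ballI finite_lessThan open_Collect_less continuous_intros
      continuous_coord)
  finally show ?thesis .
qed

lemma spectral_domain_strict:
  assumes y: "y \<in> spectral_domain n e" and "i < j" "j < n"
  shows "coord e y j < coord e y i"
  using assms(2,3)
proof (induction j)
  case (Suc j)
  have "coord e y (Suc j) < coord e y j" using y Suc.prems by (simp add: spectral_domain_iff)
  then show ?case using Suc by (cases "i = j") auto
qed simp

lemma weight_pos:
  assumes y: "y \<in> spectral_domain n e" and "j < n"
  shows "weight n e y j > 0"
  using assms by (auto simp: weight_def spectral_domain_iff)

lemma coord_inj: "y \<in> spectral_domain n e \<Longrightarrow> inj_on (coord e y) {..<n}"
  unfolding inj_on_def by (metis lessThan_iff less_irrefl linorder_neqE_nat spectral_domain_strict)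

section \<open>The spectral map and the Lanczos map are mutually inverse\<close>

lemma jacobi_spec_lanczos_map:
  assumes y: "y \<in> spectral_domain n e"
  shows "jacobi_spec n (coord e (lanczos_map n e y)) (\<lambda>i. coord e (lanczos_map n e y) (n + i))
    (coord e y) (\<lambda>j. sqrt (weight n e y j))"
proof -
  have "jacobi_spec n (lanczos_alpha n (coord e y) (weight n e y)) (lanczos_beta n (coord e y)
    (weight n e y))
      (coord e y) (\<lambda>j. sqrt (weight n e y j))"
    using weight_pos[OF y] coord_inj[OF y] sum_weight[OF n] spectral_domain_strict[OF y]
    by (intro jacobi_spec_lanczos n) auto
  then show ?thesis
    by (subst jacobi_spec_cong[of n _ "lanczos_alpha n (coord e y) (weight n e y)" _ "lanczos_beta n
      (coord e y) (weight n e y)"])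
      (auto simp: coord_lanczos_map)
qed

lemma lanczos_map_in: "y \<in> spectral_domain n e \<Longrightarrow> lanczos_map n e y \<in> matrix_domain n e"
  using jacobi_spec_lanczos_map by (auto simp: matrix_domain_iff jacobi_spec_def)

lemma coord_cases: 
  assumes "p < 2 * n - 1" obtains "p < n" | j where "j < n - 1" "p = n + j"
  using assms by (metis add_diff_inverse_nat diff_Suc_1 less_diff_conv2 mult_2
    nat_add_left_cancel_less nat_less_le not_less not_less_eq Suc_pred' add_diff_assoc n)

lemma spectral_map_lanczos_map:
  assumes y: "y \<in> spectral_domain n e" shows "spectral_map n e (lanczos_map n e y) = y"
proof (rule vec_eq_coordI)
  fix p assume "p < 2 * n - 1"
  then show "coord e (spectral_map n e (lanczos_map n e y)) p = coord e y p"
  proof (cases rule: coord_cases)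
    case 1 then show ?thesis using coord_spectral_map(1)[OF jacobi_spec_lanczos_map[OF y]] by simp
  next
    case (2 j)
    then have "coord e y (n + j) > 0" using y by (simp add: spectral_domain_iff)
    then have "sqrt (weight n e y j) = coord e y (n + j)" using 2 by (simp add: weight_def)
    then show ?thesis using coord_spectral_map(2)[OF jacobi_spec_lanczos_map[OF y], of j] 2 by simp
  qed
qed

lemma matrix_domain_jacobi_spec:
  assumes "x \<in> matrix_domain n e"
  obtains lam q where "jacobi_spec n (coord e x) (\<lambda>i. coord e x (n + i)) lam q"
  using jacobi_spec_exists[of n "\<lambda>i. coord e x (n + i)" "coord e x"] n assms
    by (auto simp: matrix_domain_iff)

text \<open>Below \<open>n - 1\<close> the weight is a squared coordinate; the last weight agrees
  because the squared first components sum to 1.\<close>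

lemma weight_spectral_map:
  assumes s: "jacobi_spec n (coord e x) (\<lambda>i. coord e x (n + i)) lam q" and j: "j < n"
  shows "weight n e (spectral_map n e x) j = (q j)\<^sup>2"
proof -
  obtain m where m: "n = Suc m" using n by (cases n) auto
  have s2: "(\<Sum>i<n - 1. (coord e (spectral_map n e x) (n + i))\<^sup>2) = (\<Sum>i<n - 1. (q i)\<^sup>2)"
    using coord_spectral_map(2)[OF s] by (intro sum.cong) auto
  show ?thesis
  proof (cases "j < n - 1")
    case True then show ?thesis using coord_spectral_map(2)[OF s] by (simp add: weight_def)
  next
    case False
    then have "j = m" using j m by simp
    then show ?thesis using jacobi_spec_sum_squares[OF s n] s2 by (simp add: weight_def m)
  qed
qed

lemma spectral_map_in:
  assumes x: "x \<in> matrix_domain n e" shows "spectral_map n e x \<in> spectral_domain n e"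
proof -
  obtain lam q where s: "jacobi_spec n (coord e x) (\<lambda>i. coord e x (n + i)) lam q"
    using matrix_domain_jacobi_spec[OF x] by blast
  \<comment> \<open>Positivity of the last weight is the strict bound on the sum of squares.\<close>
  have "q (n - 1) > 0" using n s by (simp add: jacobi_spec_def)
  then have "weight n e (spectral_map n e x) (n - 1) > 0"
    using weight_spectral_map[OF s, of "n - 1"] n by simp
  then show ?thesis
    using s coord_spectral_map[OF s] by (auto simp: spectral_domain_iff weight_def jacobi_spec_def)
qed

lemma lanczos_map_spectral_map:
  assumes x: "x \<in> matrix_domain n e" shows "lanczos_map n e (spectral_map n e x) = x"
proof -
  obtain lam q where s: "jacobi_spec n (coord e x) (\<lambda>i. coord e x (n + i)) lam q"
    using matrix_domain_jacobi_spec[OF x] by blast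
  let ?y = "spectral_map n e x"
  note w = weight_spectral_map[OF s] and l = coord_spectral_map(1)[OF s]
  have a: "lanczos_alpha n (coord e ?y) (weight n e ?y) k = coord e x k" if "k < n" for k
    using lanczos_vec_cong[where n = n and k = k and w = "weight n e ?y" and w' = "\<lambda>j. (q j)\<^sup>2"
      and lam = "coord e ?y" and lam' = lam]
      w l jacobi_spec_imp_lanczos(1)[OF s n that] by simp
  have b: "lanczos_beta n (coord e ?y) (weight n e ?y) k = coord e x (n + k)" if "k < n - 1" for k
    using lanczos_beta_cong[where n = n and k = k and w = "weight n e ?y" and w' = "\<lambda>j. (q j)\<^sup>2"
      and lam = "coord e ?y" and lam' = lam]
      w l jacobi_spec_imp_lanczos(2)[OF s n, of k] that by simp
  show ?thesis
  proof (rule vec_eq_coordI)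
    fix p assume "p < 2 * n - 1"
    then show "coord e (lanczos_map n e ?y) p = coord e x p"
      by (cases rule: coord_cases) (simp_all add: coord_lanczos_map a b)
  qed
qed

lemma bij_spectral_map: "bij_betw (spectral_map n e) (matrix_domain n e) (spectral_domain n e)"
  by (rule bij_betw_byWitness[where f' = "lanczos_map n e"])
    (use lanczos_map_spectral_map spectral_map_lanczos_map spectral_map_in lanczos_map_in in auto)

lemma inv_into_spectral_map:
  assumes "y \<in> spectral_domain n e"
  shows "inv_into (matrix_domain n e) (spectral_map n e) y = lanczos_map n e y"
  using assms bij_spectral_map
  by (intro inv_into_f_eq) (auto simp: bij_betw_def lanczos_map_in spectral_map_lanczos_map)

section \<open>Differentiability of the inverse and its Jacobian\<close>

lemma coord_differentiable: "(\<lambda>y. coord e y p) differentiable (at y)"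
  unfolding differentiable_def coord_def
  using bounded_linear_imp_has_derivative[OF bounded_linear_vec_nth] by blast

lemma lanczos_map_differentiable:
  assumes y: "y \<in> spectral_domain n e" shows "lanczos_map n e differentiable (at y)"
proof -
  have dw: "(\<lambda>y. weight n e y j) differentiable (at y)" for j
    unfolding weight_def using coord_differentiable by (cases "j < n
      - 1") (auto intro!: derivative_intros)
  have pos: "wnorm n (weight n e y) (lanczos_vec n (coord e y) (weight n e y) k) > 0" if "k < n" for k
    using weight_pos[OF y] coord_inj[OF y] that by (intro wnorm_lanczos_vec_pos n) auto
  have nz: "wnorm n (weight n e y) (lanczos_vec n (coord e y) (weight n e y) k) \<noteq> 0" if "k < n" for k
    using pos[OF that] by simp
  have comp: "(\<lambda>y. coord e (lanczos_map n e y) p) differentiable (at y)" if "p < 2 * n - 1" for p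
    using that
  proof (cases rule: coord_cases)
    case 1
    have "(\<lambda>y. lanczos_alpha n (coord e y) (weight n e y) p) differentiable (at y)"
      using lanczos_alpha_differentiable[where n = n and lam = "\<lambda>j y. coord e y j" and w
        = "\<lambda>j y. weight n e y j" and y = y and k = p,
          OF coord_differentiable dw] nz 1 by simp
    then show ?thesis using 1 by (simp add: coord_lanczos_map)
  next
    case (2 j)
    have "(\<lambda>y. lanczos_beta n (coord e y) (weight n e y) j) differentiable (at y)"
      using lanczos_beta_differentiable[where n = n and lam = "\<lambda>j y. coord e y j" and w
        = "\<lambda>j y. weight n e y j" and y = y and k = j,
          OF coord_differentiable dw] nz pos[of j] pos[of "Suc j"] 2 by simp
    then show ?thesis using 2 by (simp add: coord_lanczos_map)
  qed
  have "(\<lambda>y. lanczos_map n e y \<bullet> i) differentiable (at y)" if i: "i \<in> Basis" for i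
  proof -
    obtain k where k: "i = axis k 1" using i by (auto simp: Basis_vec_def)
    obtain p where "p < 2 * n - 1" "k = e p" by (rule enum_cases)
    then show ?thesis using comp[of p] by (simp add: k inner_axis coord_def)
  qed
  then show ?thesis by (subst differentiable_componentwise_within) auto
qed

lemma coord_line: "coord e (y + s *\<^sub>R axis (e c) 1) p = coord e y p + s * (if p = c then 1 else 0)"
  if "p < 2 * n - 1" "c < 2 * n - 1"
  using that enum_eq_iff[of p c] by (auto simp: coord_def axis_def)

text \<open>Moving along a coordinate line gives one column of the Jacobian matrix. The
  orthogonality relations persist along the line, so differentiating them yields the triangular
  system of \<open>jacobian_value\<close>.\<close>

lemma jacobian:
  assumes y: "y \<in> spectral_domain n e" and D: "(lanczos_map n e has_derivative D) (at y)"
  shows "\<bar>Determinants.det (matrix D)\<bar> = 1 / sqrt (weight n e y (n - 1)) *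
    ((\<Prod>i<n - 1. coord e (lanczos_map n e y) (n + i)) / (\<Prod>j<n. sqrt (weight n e y j)))"
proof -
  define x where "x = lanczos_map n e y"
  define q where "q j = sqrt (weight n e y j)" for j
  define d where "d p c = coord e (D (axis (e c) 1)) p" for p c
  have s: "jacobi_spec n (coord e x) (\<lambda>i. coord e x (n + i)) (coord e y) q"
    unfolding x_def q_def[abs_def] by (rule jacobi_spec_lanczos_map[OF y])
  have qw: "weight n e y j = (q j)\<^sup>2" if "j < n" for j using weight_pos[OF y that] by (simp add: q_def)
  have qy: "coord e y (n + j) = q j" if "j < n - 1" for j
    using y that by (simp add: q_def weight_def spectral_domain_iff less_imp_le)
  have ident: "moment_partial n (coord e y) q (jacobi_poly (coord e x) (\<lambda>i. coord e x (n + i)) r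
    * jacobi_poly (coord e x) (\<lambda>i. coord e x (n + i)) (Suc r)) c =
      (offprod (\<lambda>i. coord e x (n + i)) r)\<^sup>2 * (\<Sum>i\<le>r. d i c) \<and>
    moment_partial n (coord e y) q (jacobi_poly (coord e x) (\<lambda>i. coord e x (n + i)) r
      * jacobi_poly (coord e x) (\<lambda>i. coord e x (n + i)) r) c =
      (offprod (\<lambda>i. coord e x (n + i)) r)\<^sup>2 * (\<Sum>i<r. 2 * d (n + i) c / coord e x (n + i))"
    if r: "r < n" and c: "c < 2 * n - 1" for r c
  proof -
    define z where "z s = y + s *\<^sub>R axis (e c) 1" for s :: real
    define lam' where "lam' j = (if j = c then 1 else (0::real))" for j
    define w' where "w' j = (if j < n - 1 then 2 * q j * (if n + j = c then 1 else 0)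
       else - (\<Sum>i<n - 1. 2 * q i * (if n + i = c then 1 else 0)))" for j
    have z0: "z 0 = y" by (simp add: z_def)
    have zd: "(z has_derivative (\<lambda>s. s *\<^sub>R axis (e c) 1)) (at 0)"
      unfolding z_def[abs_def] by (auto intro!: derivative_eq_intros)
    have lin: "linear D" using has_derivative_linear[OF D] .
    have dG: "((\<lambda>s. coord e (lanczos_map n e (z s)) p) has_real_derivative d p c) (at 0)" for p
    proof -
      have "((\<lambda>s. lanczos_map n e (z s)) has_derivative (\<lambda>s. D (s *\<^sub>R axis (e c) 1))) (at 0)"
        using has_derivative_compose[OF zd, of "lanczos_map n e" D] D by (simp add: z0)
      from bounded_linear.has_derivative[OF bounded_linear_vec_nth this, of "e p"]
      show ?thesis unfolding has_field_derivative_def coord_def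
        by (rule has_derivative_eq_rhs) (simp add: fun_eq_iff d_def coord_def linear_scale[OF lin])
    qed
    have dz: "((\<lambda>s. coord e (z s) p) has_real_derivative (if p = c then 1 else 0)) (at 0)" if "p < 2
      * n - 1" for p
      unfolding z_def using coord_line[OF that c] by (auto intro!: derivative_eq_intros)
    have dw: "((\<lambda>s. weight n e (z s) j) has_real_derivative w' j) (at 0)" if "j < n" for j
    proof (cases "j < n - 1")
      case True
      have "((\<lambda>s. (coord e (z s) (n + j))\<^sup>2) has_real_derivative w' j) (at 0)"
        using True by (auto intro!: derivative_eq_intros dz simp: w'_def z0 qy)
      then show ?thesis using True by (simp add: weight_def)
    next
      case False
      have "((\<lambda>s. 1 - (\<Sum>i<n - 1. (coord e (z s) (n + i))\<^sup>2)) has_real_derivative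
          0 - (\<Sum>i<n - 1. 2 * q i * (if n + i = c then 1 else 0))) (at 0)"
        by (intro DERIV_diff DERIV_const DERIV_sum) (auto intro!: derivative_eq_intros dz simp: z0 qy)
      then show ?thesis using False by (simp add: weight_def w'_def)
    qed
    \<comment> \<open>Near 0 the line stays in the open domain, which supplies the orthogonality
      relations on a neighbourhood.\<close>
    have "isCont z 0" using has_derivative_continuous[OF zd] by (simp add: continuous_within)
    then have "(z \<longlongrightarrow> z 0) (nhds 0)" by (simp only: isCont_def tendsto_at_iff_tendsto_nhds)
    then have "\<forall>\<^sub>F s in nhds 0. z s \<in> spectral_domain n e"
      using open_spectral_domain y by (intro topological_tendstoD) (auto simp: z0)
    then have ev: "\<forall>\<^sub>F s in nhds 0. \<forall>k<n. \<forall>l\<le>n.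
      (\<Sum>j<n. weight n e (z s) j * poly (jacobi_poly (\<lambda>i. coord e (lanczos_map n e (z s)) i) (\<lambda>i.
        coord e (lanczos_map n e (z s)) (n + i)) k) (coord e (z s) j)
         * poly (jacobi_poly (\<lambda>i. coord e (lanczos_map n e (z s)) i) (\<lambda>i. coord e (lanczos_map n e
           (z s)) (n + i)) l) (coord e (z s) j)) =
      (if k = l then (offprod (\<lambda>i. coord e (lanczos_map n e (z s)) (n + i)) k)\<^sup>2 else 0)"
    proof eventually_elim
      case (elim s)
      let ?x = "lanczos_map n e (z s)"
      let ?P = "jacobi_poly (coord e ?x) (\<lambda>i. coord e ?x (n + i))"
      note sp = jacobi_spec_lanczos_map[OF elim]
      show ?case
      proof (intro allI impI)
        fix k l assume k: "k < n" and l: "l \<le> n"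
        show "(\<Sum>j<n. weight n e (z s) j * poly (?P k) (coord e (z s) j)
          * poly (?P l) (coord e (z s) j)) =
          (if k = l then (offprod (\<lambda>i. coord e ?x (n + i)) k)\<^sup>2 else 0)"
        \<comment> \<open>For \<open>l = n\<close> the relation is the vanishing of the
          characteristic polynomial at the nodes.\<close>
        proof (cases "l = n")
          case True
          have "poly (?P n) (coord e (z s) j) = 0" if "j < n" for j using sp that
            by (simp add: jacobi_spec_def)
          then show ?thesis using True k by simp
        next
          case False
          have "(\<Sum>j<n. weight n e (z s) j * poly (?P k) (coord e (z s) j)
            * poly (?P l) (coord e (z s) j)) =
            (\<Sum>j<n. (sqrt (weight n e (z s) j))\<^sup>2 * poly (?P k) (coord e (z s) j)
              * poly (?P l) (coord e (z s) j))"
            using weight_pos[OF elim] by (intro sum.cong) (simp_all add: less_imp_le)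
          then show ?thesis using jacobi_spec_orthonormal[OF sp k, of l] False l by simp
        qed
      qed
    qed
    have nz: "coord e (lanczos_map n e (z 0)) (n + i) \<noteq> 0" if "Suc i < n" for i
      using lanczos_map_in[OF y] that by (simp add: z0 matrix_domain_iff less_imp_neq[symmetric])
    have md: "moment_deriv n (coord e y) (weight n e y) lam' w' p
      = moment_partial n (coord e y) q p c" for p
      by (rule moment_deriv_unit[OF n c]) (auto simp: lam'_def w'_def qw)
    note main = moment_deriv_jacobi_poly[where n = n and t = 0 and k = r
      and \<alpha> = "\<lambda>i s. coord e (lanczos_map n e (z s)) i" and \<beta>
        = "\<lambda>i s. coord e (lanczos_map n e (z s)) (n + i)"
      and lam = "\<lambda>j s. coord e (z s) j" and w = "\<lambda>j s. weight n e (z s) j"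
      and \<alpha>' = "\<lambda>i. d i c" and \<beta>' = "\<lambda>i. d (n + i) c" and lam' = lam' and w' = w',
      OF dG dG _ dw nz ev r]
    have dl: "((\<lambda>s. coord e (z s) j) has_real_derivative lam' j) (at 0)" if "j < n" for j
      unfolding lam'_def using that by (intro dz) simp
    show ?thesis using main[OF dl] by (simp add: z0 x_def[symmetric] md)
  qed
  have "\<bar>fdet (2 * n - 1) d\<bar> = 1 / q (n - 1) * ((\<Prod>i<n - 1. coord e x (n + i)) / (\<Prod>i<n. q i))"
    using ident by (intro jacobian_value[OF s n]) auto
  moreover have "Determinants.det (matrix D) = fdet (2 * n - 1) d"
    unfolding det_eq_fdet[OF e] by (rule fdet_cong) (simp add: d_def matrix_def coord_def)
  ultimately show ?thesis by (simp add: q_def x_def)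
qed

end

theorem theorem1:
  fixes n :: nat and e :: "nat \<Rightarrow> 'd::finite"
  assumes "n \<ge> 1" and "bij_betw e {..<2 * n - 1} (UNIV :: 'd set)"
  shows
    "(\<forall>x\<in>matrix_domain n e. let T = tridiag_of n e x in
        card (spectrum T) = n \<and>
        (\<forall>k\<in>{1..n}. \<exists>!v. normalized_eigenvector T (eigval T k) v) \<and>
        (\<Sum>k\<in>{1..n}. (first_comp T k)\<^sup>2) = 1) \<and>
     bij_betw (spectral_map n e) (matrix_domain n e) (spectral_domain n e) \<and>
     (\<forall>x\<in>matrix_domain n e. let T = tridiag_of n e x in
        \<exists>D. (inv_into (matrix_domain n e) (spectral_map n e) has_derivative D)
               (at (spectral_map n e x)) \<and>
            \<bar>Determinants.det (matrix D)\<bar> =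
              1 / first_comp T n *
              ((\<Prod>i\<in>{1..<n}. coord_b n e x i) / (\<Prod>i\<in>{1..n}. first_comp T i)))"
proof (intro conjI ballI)
  note n = assms(1) and e = assms(2)
  show "bij_betw (spectral_map n e) (matrix_domain n e) (spectral_domain n e)"
    by (rule bij_spectral_map[OF n e])
  fix x assume x: "x \<in> matrix_domain n e"
  define T where "T = tridiag_of n e x"
  obtain lam q where sc: "jacobi_spec n (coord e x) (\<lambda>i. coord e x (n + i)) lam q"
    using matrix_domain_jacobi_spec[OF n e x] by blast
  note s = sc[folded jacobi_spec_coord[OF n e]]
  have T: "T = tridiag n (coord_a n e x) (coord_b n e x)" by (simp add: T_def tridiag_of_def)
  note ev = jacobi_spec_eigval[OF s n, folded T] and fc = jacobi_spec_first_comp[OF s n, folded T]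
  have "card (spectrum T) = n"
    unfolding T jacobi_spec_spectrum[OF s n] using jacobi_spec_inj[OF s] by (simp add: card_image)
  moreover have "\<exists>!v. normalized_eigenvector T (eigval T k) v" if k: "k \<in> {1..n}" for k
  proof -
    obtain j where "k = Suc j" "j < n" using k by (cases k) auto
    then show ?thesis using ev[of j] jacobi_spec_normalized_eigenvector[OF s n, of j, folded T] by simp
  qed
  moreover have "(\<Sum>k\<in>{1..n}. (first_comp T k)\<^sup>2) = 1"
    using jacobi_spec_sum_squares[OF s n] fc by (simp add: sum.atLeast1_atMost_eq)
  ultimately show "let T = tridiag_of n e x in card (spectrum T) = n \<and>
      (\<forall>k\<in>{1..n}. \<exists>!v. normalized_eigenvector T (eigval T k) v) \<and> (\<Sum>k\<in>{1..n}. (first_comp T k)\<^sup>2) = 1"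
    unfolding T_def[symmetric] Let_def by blast
  define y where "y = spectral_map n e x"
  have y: "y \<in> spectral_domain n e" unfolding y_def by (rule spectral_map_in[OF n e x])
  have yx: "lanczos_map n e y = x" unfolding y_def by (rule lanczos_map_spectral_map[OF n e x])
  \<comment> \<open>This includes the last index, which is not among the coordinates.\<close>
  have w: "sqrt (weight n e y j) = q j" if "j < n" for j
    using weight_spectral_map[OF n e sc that] s that by (simp add: y_def jacobi_spec_def less_imp_le)
  obtain D where D: "(lanczos_map n e has_derivative D) (at y)"
    using lanczos_map_differentiable[OF n e y] by (auto simp: differentiable_def)
  \<comment> \<open>The inverse coincides with \<open>lanczos_map\<close> on an open set around
    \<open>y\<close>, so it has the same derivative there.\<close>
  have "(inv_into (matrix_domain n e) (spectral_map n e) has_derivative D) (at y)"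
    by (rule has_derivative_transform_within_open[OF D open_spectral_domain[OF n e] y])
      (simp add: inv_into_spectral_map[OF n e])
  moreover have "\<bar>Determinants.det (matrix D)\<bar> = 1 / first_comp T n *
      ((\<Prod>i\<in>{1..<n}. coord_b n e x i) / (\<Prod>i\<in>{1..n}. first_comp T i))"
  proof -
    \<comment> \<open>The labels of \<open>coord_b\<close> run from the bottom and those of
      \<open>coord\<close> from the top, hence the reflection.\<close>
    have "(\<Prod>i\<in>{1..<n}. coord_b n e x i) = (\<Prod>i<n - 1. coord e x (n + i))"
      by (rule prod.reindex_bij_witness[where i = "\<lambda>i. n - 1 - i" and j = "\<lambda>i. n - 1 - i"])
        (auto simp: coord_b_def coord_def)
    moreover have "(\<Prod>i\<in>{1..n}. first_comp T i) = (\<Prod>j<n. q j)"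
      using fc by (simp add: prod.atLeast1_atMost_eq)
    moreover have "first_comp T n = q (n - 1)" using fc[of "n - 1"] n by simp
    moreover have "(\<Prod>j<n. sqrt (weight n e y j)) = (\<Prod>j<n. q j)" using w by simp
    ultimately show ?thesis using jacobian[OF n e y D] w[of "n - 1"] n by (simp add: yx)
  qed
  ultimately show "let T = tridiag_of n e x in
        \<exists>D. (inv_into (matrix_domain n e) (spectral_map n e) has_derivative D)
               (at (spectral_map n e x)) \<and>
            \<bar>Determinants.det (matrix D)\<bar> =
              1 / first_comp T n *
              ((\<Prod>i\<in>{1..<n}. coord_b n e x i) / (\<Prod>i\<in>{1..n}. first_comp T i))"
    unfolding T_def[symmetric] Let_def y_def by blast
qed

end
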